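(* Let $R=\mathbb{K}[x_{i,i+1},x_{i,i+2}: i\in\mathbb{N}]$ and $I=\ker\varphi$, where $\varphi: R\to\mathbb{K}[x_i: i\in\mathbb{N}]$ is the $\mathbb{K}$-algebra homomorphism with $\varphi(x_{i,i+1})=x_ix_{i+1}$ and $\varphi(x_{i,i+2})=x_ix_{i+2}$. Then the set $\mathcal{G}=\{g_2\}\cup\{g^{\mathbf{s}}: \mathbf{s}\in\{1,2\}^n, n\in\mathbb{N}_0\}$ generates $I$ minimally up to shift: the shifts $\operatorname{sh}_k(g)$, $g\in\mathcal{G}$, $k\in\mathbb{N}_0$, generate $I$ as an ideal, and for no proper subset of $\mathcal{G}$ do the shifts of its elements generate $I$.
   Context: $\mathbb{K}$ is a field. The shift $\operatorname{sh}_k$ ($k\in\mathbb{N}_0$) is the ring endomorphism of $R$ with $x_{i,j}\mapsto x_{i+k,j+k}$. Let $E=\{[i,i+1],[i,i+2]: i\in\mathbb{N}\}$ (index pairs of the variables), totally ordered by $[i,j]\le[k,l]$ iff $i\le k$ and $j\le l$. For a binomial $g=\prod x_{i,j}^{u_{i,j}}-\prod x_{i,j}^{v_{i,j}}$ set $w_g([i,j])=u_{i,j}-v_{i,j}$; conversely, for a finitely supported $w:E\to\mathbb{Z}$ the associated binomial is $\prod_{[i,j]\in E}x_{i,j}^{\max(w([i,j]),0)}-\prod_{[i,j]\in E}x_{i,j}^{\max(-w([i,j]),0)}$. A vertex $n\in\mathbb{N}$ is adjacent to $g$ if $n\in\{i,j\}$ for some $[i,j]$ with $w_g([i,j])\ne0$.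 Set $g_2=x_{1,2}x_{3,4}-x_{1,3}x_{2,4}$ and $g^{\emptyset}=x_{1,2}x_{3,5}^2x_{6,7}-x_{1,3}x_{2,3}x_{5,6}x_{5,7}$. For a finite sequence $\mathbf{s}=(s_1,\dots,s_n)\in\{1,2\}^n$ write $\mathbf{s}1=(s_1,\dots,s_n,1)$, $\mathbf{s}2=(s_1,\dots,s_n,2)$. Recursively, if $g^{\mathbf{s}}$ is defined with $w=w_{g^{\mathbf{s}}}$ and $k$ is the largest vertex adjacent to $g^{\mathbf{s}}$, then $g^{\mathbf{s}1}$ and $g^{\mathbf{s}2}$ are the binomials associated to the weight functions $w_{g^{\mathbf{s}1}}([i,j])=w([i,j])$ if $[i,j]\le[k-4,k-2]$; $=2w([i,j])$ if $[i,j]=[k-2,k]$; $=-w([i-2,j-2])$ if $[i,j]\ge[k,k+1]$; $=0$ otherwise; $w_{g^{\mathbf{s}2}}([i,j])=w([i,j])$ if $[i,j]\le[k-4,k-2]$; $=2w([i,j])$ if $[i,j]=[k-2,k-1]$; $=-2w([k-2,k-1])$ if $[i,j]=[k-1,k+1]$; $=w([i-3,j-3])$ if $[i,j]\ge[k+1,k+2]$; $=0$ otherwise. *)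

theory Defs
  imports "HOL-Library.Poly_Mapping"
begin

text \<open>Variables are indexed by pairs (i,j) of naturals; monomials are finitely supported
  exponent maps; polynomials with coefficients in 'k are finitely supported maps from
  monomials to 'k.  The ring R is the subring of polynomials only involving variables
  x_{i,j} with [i,j] in Eset.\<close>

type_synonym mon = "(nat \<times> nat) \<Rightarrow>\<^sub>0 nat"
type_synonym 'k pol = "mon \<Rightarrow>\<^sub>0 'k"
type_synonym 'k upol = "(nat \<Rightarrow>\<^sub>0 nat) \<Rightarrow>\<^sub>0 'k"

definition Eset :: "(nat \<times> nat) set" where
  "Eset = {(i, i + 1) | i. i \<ge> 1} \<union> {(i, i + 2) | i. i \<ge> 1}"

definition R :: "'k::field pol set" where
  "R = {p. \<forall>m. m \<in> Poly_Mapping.keys (p :: 'k pol) \<longrightarrow> Poly_Mapping.keys (m :: mon) \<subseteq> Eset}"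

definition phi_mon :: "mon \<Rightarrow> (nat \<Rightarrow>\<^sub>0 nat)" where
  "phi_mon m = (\<Sum>v \<in> Poly_Mapping.keys m. Poly_Mapping.single (fst v) (Poly_Mapping.lookup m v)
                              + Poly_Mapping.single (snd v) (Poly_Mapping.lookup m v))"

definition phi :: "'k::field pol \<Rightarrow> 'k upol" where
  "phi p = (\<Sum>m \<in> Poly_Mapping.keys p. Poly_Mapping.single (phi_mon m) (Poly_Mapping.lookup p m))"

definition I :: "'k::field pol set" where
  "I = {p \<in> R. phi p = 0}"

definition ideal_gen_R :: "'k::field pol set \<Rightarrow> 'k pol set" where
  "ideal_gen_R S = {(\<Sum>g \<in> F. c g * g) | F c. finite F \<and> F \<subseteq> S \<and> (\<forall>g \<in> F. c g \<in> R)}"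

definition sh_mon :: "nat \<Rightarrow> mon \<Rightarrow> mon" where
  "sh_mon k m = (\<Sum>v \<in> Poly_Mapping.keys m. Poly_Mapping.single (fst v + k, snd v + k) (Poly_Mapping.lookup m v))"

definition sh :: "nat \<Rightarrow> 'k::field pol \<Rightarrow> 'k pol" where
  "sh k p = (\<Sum>m \<in> Poly_Mapping.keys p. Poly_Mapping.single (sh_mon k m) (Poly_Mapping.lookup p m))"

definition var :: "nat \<Rightarrow> nat \<Rightarrow> 'k::field pol" where
  "var i j = Poly_Mapping.single (Poly_Mapping.single (i, j) 1) 1"

definition g2 :: "'k::field pol" where
  "g2 = var 1 2 * var 3 4 - var 1 3 * var 2 4"

definition weight :: "mon \<Rightarrow> mon \<Rightarrow> (nat \<times> nat) \<Rightarrow> int" where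
  "weight u v e = int (Poly_Mapping.lookup u e) - int (Poly_Mapping.lookup v e)"

definition pos_mon :: "((nat \<times> nat) \<Rightarrow> int) \<Rightarrow> mon" where
  "pos_mon w = (\<Sum>e \<in> {e \<in> Eset. w e \<noteq> 0}. Poly_Mapping.single e (nat (max (w e) 0)))"

definition neg_mon :: "((nat \<times> nat) \<Rightarrow> int) \<Rightarrow> mon" where
  "neg_mon w = (\<Sum>e \<in> {e \<in> Eset. w e \<noteq> 0}. Poly_Mapping.single e (nat (max (- w e) 0)))"

definition binom :: "((nat \<times> nat) \<Rightarrow> int) \<Rightarrow> 'k::field pol" where
  "binom w = Poly_Mapping.single (pos_mon w) 1 - Poly_Mapping.single (neg_mon w) 1"

definition u0 :: mon where
  "u0 = Poly_Mapping.single (1,2) 1 + Poly_Mapping.single (3,5) 2 + Poly_Mapping.single (6,7) 1"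
definition v0 :: mon where
  "v0 = Poly_Mapping.single (1,3) 1 + Poly_Mapping.single (2,3) 1
      + Poly_Mapping.single (5,6) 1 + Poly_Mapping.single (5,7) 1"

definition g_empty :: "'k::field pol" where
  "g_empty = Poly_Mapping.single u0 1 - Poly_Mapping.single v0 1"

definition le_E :: "nat \<times> nat \<Rightarrow> nat \<times> nat \<Rightarrow> bool" where
  "le_E a b \<longleftrightarrow> fst a \<le> fst b \<and> snd a \<le> snd b"

definition maxvert :: "((nat \<times> nat) \<Rightarrow> int) \<Rightarrow> nat" where
  "maxvert w = Max {n. \<exists>e \<in> Eset. w e \<noteq> 0 \<and> (n = fst e \<or> n = snd e)}"

definition step1 :: "((nat \<times> nat) \<Rightarrow> int) \<Rightarrow> (nat \<times> nat) \<Rightarrow> int" where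
  "step1 w e = (let k = maxvert w in
     if e \<notin> Eset then 0
     else if le_E e (k - 4, k - 2) then w e
     else if e = (k - 2, k) then 2 * w e
     else if le_E (k, k + 1) e then - w (fst e - 2, snd e - 2)
     else 0)"

definition step2 :: "((nat \<times> nat) \<Rightarrow> int) \<Rightarrow> (nat \<times> nat) \<Rightarrow> int" where
  "step2 w e = (let k = maxvert w in
     if e \<notin> Eset then 0
     else if le_E e (k - 4, k - 2) then w e
     else if e = (k - 2, k - 1) then 2 * w e
     else if e = (k - 1, k + 1) then - 2 * w (k - 2, k - 1)
     else if le_E (k + 1, k + 2) e then w (fst e - 3, snd e - 3)
     else 0)"

text \<open>Weight of g^s for a sequence s (list over {1,2}), built by appending at the end.\<close>
fun wseq_rev :: "nat list \<Rightarrow> (nat \<times> nat) \<Rightarrow> int" where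
  "wseq_rev [] = weight u0 v0"
| "wseq_rev (a # s) = (if a = 1 then step1 (wseq_rev s) else step2 (wseq_rev s))"

definition gs :: "nat list \<Rightarrow> 'k::field pol" where
  "gs s = (if s = [] then g_empty else binom (wseq_rev (rev s)))"

definition G :: "'k::field pol set" where
  "G = {g2} \<union> {gs s | s. set s \<subseteq> {1, 2}}"

definition shifts :: "'k::field pol set \<Rightarrow> 'k pol set" where
  "shifts H = {sh k g | k g. g \<in> H}"

end

theory Submission
  imports Defs
begin

text \<open>
  A monomial of the ring is a multigraph on the positive integers with edges of length 1 or 2, and
  \<open>phi\<close> records its vertex degrees. Since \<open>I\<close> is spanned by binomials \<open>x\<^sup>u - x\<^sup>v\<close> with equal degrees,
  generation means that any two multigraphs \<open>u\<close>, \<open>v\<close> with the same degrees are connected by moves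
  from \<open>G\<close>. By induction on the number of edges it suffices to move them until they share an edge.
  At the lowest vertex one of them uses only the short and the other only the long edge (otherwise
  an edge is shared), and excluding applications of the quadric forces the first triangle of some
  \<open>g\<^sup>s\<close> and its first path edge. Comparing degrees at the current end \<open>k\<close> of the path, either an edge
  can be shared, or one of the two multigraphs contains a whole monomial of \<open>g\<^sup>s\<close>, or the path
  continues by \<open>k, k+2\<close> or by \<open>k, k+1, k+3\<close>, which are exactly the two recursion steps defining \<open>G\<close>.

  For minimality, the support of \<open>g\<^sup>s\<close> induces a chordless path between two triangles, so the fiber
  of its monomials consists of just these two, which are coprime. Hence no shift of another generator
  has a monomial dividing one of them, and every element of the ideal generated by the other shifts
  has coefficient 0 there.
\<close>

abbreviation lookup where "lookup \<equiv> Poly_Mapping.lookup"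
abbreviation keys where "keys \<equiv> Poly_Mapping.keys"
abbreviation single where "single \<equiv> Poly_Mapping.single"

subsection \<open>Additive extensions\<close>

lemma sum_single_keys: "(\<Sum>x\<in>keys p. single x (lookup p x)) = p"
proof (rule poly_mapping_eqI)
  fix y
  have "lookup (\<Sum>x\<in>keys p. single x (lookup p x)) y
      = (\<Sum>x\<in>keys p. if x = y then lookup p y else 0)"
    unfolding lookup_sum by (rule sum.cong) (auto simp: lookup_single when_def)
  also have "\<dots> = lookup p y"
    by (simp add: in_keys_iff)
  finally show "lookup (\<Sum>x\<in>keys p. single x (lookup p x)) y = lookup p y" .
qed

lemma phi_mon_add: "phi_mon (m + m') = phi_mon m + phi_mon m'"
  unfolding phi_mon_def
  by (rule setsum_keys_plus_distrib) (simp_all add: single_add algebra_simps)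

lemma sh_mon_add: "sh_mon k (m + m') = sh_mon k m + sh_mon k m'"
  unfolding sh_mon_def
  by (rule setsum_keys_plus_distrib) (simp_all add: single_add)

lemma phi_add: "phi (p + q) = phi p + phi q"
  unfolding phi_def by (rule setsum_keys_plus_distrib) (simp_all add: single_add)

lemma sh_add: "sh k (p + q) = sh k p + sh k q"
  unfolding sh_def by (rule setsum_keys_plus_distrib) (simp_all add: single_add)

lemma phi_mon_single: "phi_mon (single (i, j) c) = single i c + single j c"
  by (cases "c = 0") (simp_all add: phi_mon_def)

lemma sh_mon_single: "sh_mon k (single (i, j) c) = single (i + k, j + k) c"
  by (cases "c = 0") (simp_all add: sh_mon_def)

lemma phi_single: "phi (single m c) = single (phi_mon m) c"
  by (cases "c = 0") (simp_all add: phi_def)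

lemma sh_single: "sh k (single m c) = single (sh_mon k m) c"
  by (cases "c = 0") (simp_all add: sh_def)

lemma phi_zero: "phi 0 = 0"
  by (simp add: phi_def)

lemma phi_sum: "phi (\<Sum>x\<in>F. f x) = (\<Sum>x\<in>F. phi (f x))"
  by (induction F rule: infinite_finite_induct) (simp_all add: phi_zero phi_add)

lemma phi_diff: "phi (p - q) = phi p - phi q"
  using phi_add[of "p - q" q] by simp

lemma sh_diff: "sh k (p - q) = sh k p - sh k q"
  using sh_add[of k "p - q" q] by simp

section \<open>Vertex degrees of a multigraph\<close>

definition vdeg :: "mon \<Rightarrow> nat \<Rightarrow> nat" where
  "vdeg m n = lookup (phi_mon m) n"

lemma vdeg_add [simp]: "vdeg (m + m') n = vdeg m n + vdeg m' n"
  by (simp add: vdeg_def phi_mon_add lookup_add)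

lemma vdeg_single [simp]:
  "vdeg (single (i, j) c) n = (if i = n then c else 0) + (if j = n then c else 0)"
  by (simp add: vdeg_def phi_mon_single lookup_add lookup_single when_def)

lemma vdeg_zero [simp]: "vdeg 0 n = 0"
  by (simp add: vdeg_def phi_mon_def)

lemma vdeg_sum: "vdeg (\<Sum>x\<in>F. f x) n = (\<Sum>x\<in>F. vdeg (f x) n)"
  by (induction F rule: infinite_finite_induct) simp_all

lemma phi_mon_eq_iff: "phi_mon m = phi_mon m' \<longleftrightarrow> (\<forall>n. vdeg m n = vdeg m' n)"
  unfolding vdeg_def by (metis poly_mapping_eqI)

lemma Eset_iff: "(i, j) \<in> Eset \<longleftrightarrow> i \<ge> 1 \<and> (j = i + 1 \<or> j = i + 2)"
  by (auto simp: Eset_def)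

text \<open>Exponents are natural numbers, so no variable cancels in a product of monomials.\<close>

lemma keys_add_Eset: "keys (m + m') \<subseteq> Eset \<longleftrightarrow> keys m \<subseteq> Eset \<and> keys m' \<subseteq> Eset" for m m' :: mon
  by (simp add: in_keys_iff lookup_add subset_iff) blast

lemma lookup_outside_Eset: "keys m \<subseteq> Eset \<Longrightarrow> (i, j) \<notin> Eset \<Longrightarrow> lookup m (i, j) = 0"
  by (auto simp: in_keys_iff)

text \<open>Truncated subtraction does no harm here: for \<open>n < 2\<close> the pairs it affects lie outside
  \<open>Eset\<close>.\<close>

lemma vdeg_eq:
  assumes "keys m \<subseteq> Eset"
  shows "vdeg m n = lookup m (n - 2, n) + lookup m (n - 1, n)
    + lookup m (n, n + 1) + lookup m (n, n + 2)"
proof -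
  \<comment> \<open>Both sides are additive in the monomial, so the formula only has to be checked
    on one edge of \<open>Eset\<close>.\<close>
  have "vdeg (single v c) n = lookup (single v c) (n - 2, n) + lookup (single v c) (n - 1, n)
      + lookup (single v c) (n, n + 1) + lookup (single v c) (n, n + 2)" if "v \<in> Eset" for v c
    using that by (cases v) (auto simp: Eset_iff lookup_single when_def)
  then have "(\<Sum>v\<in>keys m. vdeg (single v (lookup m v)) n) =
     (\<Sum>v\<in>keys m. lookup (single v (lookup m v)) (n - 2, n) + lookup (single v (lookup m v)) (n - 1, n)
      + lookup (single v (lookup m v)) (n, n + 1) + lookup (single v (lookup m v)) (n, n + 2))"
    using assms by (intro sum.cong) auto
  then show ?thesis
    unfolding sum.distrib
    by (simp only: vdeg_sum[symmetric] lookup_sum[symmetric] sum_single_keys)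
qed

text \<open>A degree is a sum of nonnegative exponents, so a vertex of degree 0 has no incident
  edge. This is the main means of excluding edges below.\<close>

lemma vdeg_eq_0_lookup:
  assumes "keys m \<subseteq> Eset" and "vdeg m i = 0 \<or> vdeg m j = 0"
  shows "lookup m (i, j) = 0"
proof (cases "(i, j) \<in> Eset")
  case True
  then show ?thesis
    using assms(2) vdeg_eq[OF assms(1), of i] vdeg_eq[OF assms(1), of j]
    by (auto simp: Eset_iff)
next
  case False
  then show ?thesis
    using assms(1) by (rule lookup_outside_Eset[rotated])
qed

lemma vdeg_all_0_imp_0:
  assumes "keys m \<subseteq> Eset" and "\<And>n. vdeg m n = 0"
  shows "m = 0"
proof (rule poly_mapping_eqI)
  fix x
  show "lookup m x = lookup 0 x"
    using vdeg_eq_0_lookup[OF assms(1)] assms(2) by (cases x) simp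
qed

lemma vdeg_0_eq_0:
  assumes "keys m \<subseteq> Eset" shows "vdeg m 0 = 0"
  using vdeg_eq[OF assms, of 0] lookup_outside_Eset[OF assms] by (simp add: Eset_iff)

lemma le_imp_add_diff:
  fixes m u :: mon
  assumes "\<And>x. lookup m x \<le> lookup u x"
  shows "m + (u - m) = u"
  using assms by (intro poly_mapping_eqI) (simp add: lookup_add minus_poly_mapping.rep_eq)

subsection \<open>Triangles joined by a path\<close>

abbreviation edge :: "nat \<Rightarrow> nat \<Rightarrow> mon" where
  "edge i j \<equiv> single (i, j) 1"

abbreviation edge2 :: "nat \<Rightarrow> nat \<Rightarrow> mon" where
  "edge2 i j \<equiv> single (i, j) 2"

text \<open>Lists are in the reversed order of \<^const>\<open>wseq_rev\<close>. The binomial \<open>g\<^sup>s\<close>, shifted by \<open>t\<close>,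
  lives on the triangle \<open>t+1, t+2, t+3\<close>, a path from \<open>t+3\<close> to \<open>k = path_end t s\<close>, and the
  triangle \<open>k, k+1, k+2\<close>. Its monomials are \<open>heavy_mon\<close> and \<open>light_mon\<close>; \<open>heavy_part\<close> (which
  contains the last path edge twice) and \<open>light_part\<close> are what remains of them when the last
  triangle is removed.\<close>

fun path_end :: "nat \<Rightarrow> nat list \<Rightarrow> nat" where
  "path_end t [] = t + 5"
| "path_end t (a # s) = (if a = 1 then path_end t s + 2 else path_end t s + 3)"

fun heavy_part light_part :: "nat \<Rightarrow> nat list \<Rightarrow> mon" where
  "heavy_part t [] = edge (t + 1) (t + 2) + edge2 (t + 3) (t + 5)"
| "heavy_part t (a # s) =
    (if a = 1 then light_part t s + edge2 (path_end t s) (path_end t s + 2)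
     else heavy_part t s + edge2 (path_end t s + 1) (path_end t s + 3))"
| "light_part t [] = edge (t + 1) (t + 3) + edge (t + 2) (t + 3)"
| "light_part t (a # s) =
    (if a = 1 then heavy_part t s
     else light_part t s + edge2 (path_end t s) (path_end t s + 1))"

definition heavy_mon :: "nat \<Rightarrow> nat list \<Rightarrow> mon" where
  "heavy_mon t s = heavy_part t s + edge (path_end t s + 1) (path_end t s + 2)"

definition light_mon :: "nat \<Rightarrow> nat list \<Rightarrow> mon" where
  "light_mon t s = light_part t s + edge (path_end t s) (path_end t s + 1)
     + edge (path_end t s) (path_end t s + 2)"

lemma path_end_ge: "path_end t s \<ge> t + 5"
  by (induction s) auto

text \<open>Edges appended at the path end are thereby new to both parts. The light part moreover
  avoids the vertices \<open>path_end t s - 1\<close> and \<open>path_end t s\<close>.\<close>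

lemma parts_support:
  "lookup (heavy_part t s) (i, j) \<noteq> 0 \<Longrightarrow> t < i \<and> i + 2 \<le> path_end t s \<and> j \<le> path_end t s"
  "lookup (light_part t s) (i, j) \<noteq> 0 \<Longrightarrow> t < i \<and> i + 2 \<le> path_end t s \<and> j + 2 \<le> path_end t s"
  using path_end_ge[of t s]
proof (induction s)
  case Nil
  { case 1 then show ?case by (auto simp: lookup_add lookup_single when_def split: if_splits) }
  { case 2 then show ?case by (auto simp: lookup_add lookup_single when_def split: if_splits) }
next
  case (Cons a s)
  note ge = path_end_ge[of t s]
  { case 1 then show ?case using Cons.IH ge
      by (fastforce simp: lookup_add lookup_single when_def split: if_splits) }
  { case 2 then show ?case using Cons.IH ge
      by (fastforce simp: lookup_add lookup_single when_def split: if_splits) }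
qed

lemma heavy_part_eq_0:
  "i \<le> t \<or> path_end t s < i + 2 \<or> path_end t s < j \<Longrightarrow> lookup (heavy_part t s) (i, j) = 0"
  using parts_support(1)[of t s i j] by linarith

lemma light_part_eq_0:
  "i \<le> t \<or> path_end t s < i + 2 \<or> path_end t s < j + 2 \<Longrightarrow> lookup (light_part t s) (i, j) = 0"
  using parts_support(2)[of t s i j] by linarith

lemma keys_parts: "keys (heavy_part t s) \<subseteq> Eset \<and> keys (light_part t s) \<subseteq> Eset"
proof (induction s)
  case Nil
  show ?case by (simp add: keys_add_Eset Eset_iff)
next
  case (Cons a s)
  then show ?case
    using path_end_ge[of t s] by (simp add: keys_add_Eset Eset_iff)
qed

lemma keys_heavy_mon: "keys (heavy_mon t s) \<subseteq> Eset"
  and keys_light_mon: "keys (light_mon t s) \<subseteq> Eset"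
  using keys_parts[of t s] path_end_ge[of t s]
  by (simp_all add: heavy_mon_def light_mon_def keys_add_Eset Eset_iff)

text \<open>Step 1 balances the surplus at the old path end by adding a doubled edge to the light
  side, which becomes the heavy one. Step 2 adds a doubled edge to each side and moves the surplus
  on by three vertices.\<close>

lemma vdeg_parts: "vdeg (heavy_part t s) n = vdeg (light_part t s) n + (if n = path_end t s then 2 else 0)"
  by (induction s) auto

text \<open>The last triangle balances the surplus 2: the light side gets its two edges at the path
  end, the heavy side the opposite edge.\<close>

lemma vdeg_mons: "vdeg (heavy_mon t s) n = vdeg (light_mon t s) n"
  by (simp add: heavy_mon_def light_mon_def vdeg_parts)

lemma heavy_part_last: "lookup (heavy_part t s) (path_end t s - 2, path_end t s) \<ge> 2"
proof (cases s)
  case Nil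
  then show ?thesis by (simp add: lookup_add lookup_single)
next
  case (Cons a s')
  then show ?thesis by (simp add: lookup_add)
qed

text \<open>Supplies the edge that two multigraphs share after a move by
  \<open>walk\<close>.\<close>

lemma light_part_nonzero: "\<exists>i j. lookup (light_part t s) (i, j) > 0"
proof (induction s)
  case Nil
  then show ?case by (intro exI[of _ "t + 1"] exI[of _ "t + 3"]) (simp add: lookup_add)
next
  case (Cons a s)
  show ?case
  proof (cases "a = 1")
    case True
    then show ?thesis using heavy_part_last[of t s]
      by (intro exI[of _ "path_end t s - 2"] exI[of _ "path_end t s"]) simp
  next
    case False
    then show ?thesis
      by (intro exI[of _ "path_end t s"] exI[of _ "path_end t s + 1"]) (simp add: lookup_add)
  qed
qed

subsection \<open>Connectedness of the fibers\<close>

text \<open>Connectivity in the fiber graph: \<open>quad\<close> and \<open>walk\<close> are the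
  shifted generators, and every other rule mirrors an operation available in an ideal of
  \<open>R\<close>, as used in \<open>conn_imp_ideal\<close>.\<close>

inductive conn :: "mon \<Rightarrow> mon \<Rightarrow> bool" where
  quad: "n \<ge> 1 \<Longrightarrow> conn (edge n (n + 1) + edge (n + 2) (n + 3)) (edge n (n + 2) + edge (n + 1) (n + 3))"
| walk: "set s \<subseteq> {1, 2} \<Longrightarrow> conn (heavy_mon t s) (light_mon t s)"
| refl: "conn u u"
| sym: "conn u v \<Longrightarrow> conn v u"
| trans: "conn u v \<Longrightarrow> conn v w \<Longrightarrow> conn u w"
| add: "conn u v \<Longrightarrow> keys c \<subseteq> Eset \<Longrightarrow> conn (u + c) (v + c)"

lemma conn_vdeg: "conn u v \<Longrightarrow> vdeg u n = vdeg v n"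
  by (induction rule: conn.induct) (auto simp: vdeg_mons)

text \<open>The equivalence, unlike a single implication, passes through the rule \<open>sym\<close>
  in the induction.\<close>

lemma conn_keys: "conn u v \<Longrightarrow> keys u \<subseteq> Eset \<longleftrightarrow> keys v \<subseteq> Eset"
proof (induction rule: conn.induct)
  case (walk s t)
  then show ?case by (simp add: keys_heavy_mon keys_light_mon)
next
  case (quad n)
  then show ?case by (simp add: keys_add_Eset Eset_iff)
next
  case (add u v c)
  then show ?case by (simp add: keys_add_Eset)
qed simp_all

text \<open>Cancelling the shared edge leaves a smaller pair of equal degrees, so linking is all
  that the induction in \<open>conn_fiber\<close> asks for.\<close>

definition linked :: "mon \<Rightarrow> mon \<Rightarrow> bool" where
  "linked u v \<longleftrightarrow> (\<exists>i j u' v'. conn u (edge i j + u') \<and> conn v (edge i j + v'))"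

lemma linked_sym: "linked u v \<Longrightarrow> linked v u"
  by (auto simp: linked_def)

lemma linked_conn: "conn u u' \<Longrightarrow> linked u' v \<Longrightarrow> linked u v"
  unfolding linked_def by (meson conn.trans)

lemma edge_split: "lookup u (i, j) > 0 \<Longrightarrow> edge i j + (u - edge i j) = u"
  by (rule le_imp_add_diff) (auto simp: lookup_single when_def Suc_le_eq)

lemma linked_shared:
  assumes "lookup u (i, j) > 0" "lookup v (i, j) > 0"
  shows "linked u v"
  unfolding linked_def using edge_split[OF assms(1)] edge_split[OF assms(2)] conn.refl by metis

text \<open>Exchanges the divisor \<open>a\<close> of \<open>u\<close> for \<open>b\<close>. The
  result is described by an additive equation, free of truncated subtraction, so that linear
  arithmetic applies.\<close>

lemma conn_replace:
  assumes "conn a b" "keys u \<subseteq> Eset" "\<And>x. lookup a x \<le> lookup u x"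
  obtains u' where "conn u u'" "keys u' \<subseteq> Eset" "\<And>x. lookup u' x + lookup a x = lookup u x + lookup b x"
proof -
  have u: "a + (u - a) = u"
    using assms(3) by (rule le_imp_add_diff)
  then have k: "keys (u - a) \<subseteq> Eset"
    using assms(2) by (metis keys_add_Eset)
  have "conn u (b + (u - a))"
    using conn.add[OF assms(1) k] u by simp
  moreover from this have "keys (b + (u - a)) \<subseteq> Eset"
    using conn_keys assms(2) by blast
  moreover have "lookup (b + (u - a)) x + lookup a x = lookup u x + lookup b x" for x
    using arg_cong[OF u, of "\<lambda>m. lookup m x"] by (simp add: lookup_add)
  ultimately show thesis by (rule that)
qed

lemma quad_short_to_long:
  assumes "keys u \<subseteq> Eset" "lookup u (n, n + 1) > 0" "lookup u (n + 2, n + 3) > 0"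
  obtains u' where "conn u u'" "keys u' \<subseteq> Eset" "lookup u' (n, n + 2) > 0" "lookup u' (n + 1, n + 3) > 0"
proof -
  have "n \<ge> 1"
    using assms(1,2) by (auto simp: in_keys_iff subset_iff Eset_def)
  moreover have "lookup (edge n (n + 1) + edge (n + 2) (n + 3)) x \<le> lookup u x" for x
    using assms(2,3) by (auto simp: lookup_add lookup_single when_def)
  ultimately obtain u' where u': "conn u u'" "keys u' \<subseteq> Eset"
    and eq: "\<And>x. lookup u' x + lookup (edge n (n + 1) + edge (n + 2) (n + 3)) x
      = lookup u x + lookup (edge n (n + 2) + edge (n + 1) (n + 3)) x"
    using conn_replace[OF conn.quad assms(1)] by metis
  show thesis
  proof (rule that[OF u'])
    show "lookup u' (n, n + 2) > 0" "lookup u' (n + 1, n + 3) > 0"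
      using eq[of "(n, n + 2)"] eq[of "(n + 1, n + 3)"] by (simp_all add: lookup_add lookup_single)
  qed
qed

text \<open>The last clause keeps track of what survives the move: only one copy of
  \<open>(n, n + 2)\<close> is consumed, and \<open>linked_backward\<close> relies on a second
  copy.\<close>

lemma quad_long_to_short:
  assumes "keys u \<subseteq> Eset" "lookup u (n, n + 2) > 0" "lookup u (n + 1, n + 3) > 0"
  obtains u' where "conn u u'" "keys u' \<subseteq> Eset" "lookup u' (n, n + 1) > 0" "lookup u' (n + 2, n + 3) > 0"
    "\<forall>x. x \<noteq> (n + 1, n + 3) \<longrightarrow> lookup u x \<le> lookup u' x + (if x = (n, n + 2) then 1 else 0)"
proof -
  have "n \<ge> 1"
    using assms(1,2) by (auto simp: in_keys_iff subset_iff Eset_def)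
  moreover have "lookup (edge n (n + 2) + edge (n + 1) (n + 3)) x \<le> lookup u x" for x
    using assms(2,3) by (auto simp: lookup_add lookup_single when_def)
  ultimately obtain u' where u': "conn u u'" "keys u' \<subseteq> Eset"
    and eq: "\<And>x. lookup u' x + lookup (edge n (n + 2) + edge (n + 1) (n + 3)) x
      = lookup u x + lookup (edge n (n + 1) + edge (n + 2) (n + 3)) x"
    using conn_replace[OF conn.sym[OF conn.quad] assms(1)] by metis
  show thesis
  proof (rule that[OF u'])
    show "lookup u' (n, n + 1) > 0" "lookup u' (n + 2, n + 3) > 0"
      using eq[of "(n, n + 1)"] eq[of "(n + 2, n + 3)"] by (simp_all add: lookup_add lookup_single)
    have "lookup u x \<le> lookup u' x + (if x = (n, n + 2) then 1 else 0)" if "x \<noteq> (n + 1, n + 3)" for x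
      using eq[of x] that by (simp add: lookup_add lookup_single when_def split: if_splits)
    then show "\<forall>x. x \<noteq> (n + 1, n + 3) \<longrightarrow> lookup u x \<le> lookup u' x + (if x = (n, n + 2) then 1 else 0)"
      by blast
  qed
qed

text \<open>The move replaces the heavy monomial inside \<open>u\<close> by the light one; any edge
  of the nonzero light part is then shared with \<open>v\<close>.\<close>

lemma linked_heavy:
  assumes "set s \<subseteq> {1, 2}" "keys u \<subseteq> Eset"
    and "\<And>x. lookup (heavy_mon t s) x \<le> lookup u x" "\<And>x. lookup (light_part t s) x \<le> lookup v x"
  shows "linked u v"
proof -
  obtain u' where u': "conn u u'"
    and eq: "\<And>x. lookup u' x + lookup (heavy_mon t s) x = lookup u x + lookup (light_mon t s) x"
    using conn_replace[OF conn.walk[OF assms(1)] assms(2,3)] by metis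
  obtain i j where ij: "lookup (light_part t s) (i, j) > 0"
    using light_part_nonzero by blast
  then have "lookup u' (i, j) > 0"
    using eq[of "(i, j)"] assms(3)[of "(i, j)"] by (simp add: light_mon_def lookup_add)
  moreover have "lookup v (i, j) > 0"
    using ij assms(4)[of "(i, j)"] by simp
  ultimately show ?thesis
    using linked_shared linked_conn u' by blast
qed

lemma linked_light:
  assumes "set s \<subseteq> {1, 2}" "keys u \<subseteq> Eset"
    and "\<And>x. lookup (light_mon t s) x \<le> lookup u x" "\<And>x. lookup (heavy_part t s) x \<le> lookup v x"
  shows "linked u v"
proof -
  obtain u' where u': "conn u u'"
    and eq: "\<And>x. lookup u' x + lookup (light_mon t s) x = lookup u x + lookup (heavy_mon t s) x"
    using conn_replace[OF conn.sym[OF conn.walk[OF assms(1)]] assms(2,3)] by metis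
  obtain i j where ij: "lookup (heavy_part t s) (i, j) > 0"
    using heavy_part_last[of t s] by (metis less_le_trans zero_less_numeral)
  then have "lookup u' (i, j) > 0"
    using eq[of "(i, j)"] assms(3)[of "(i, j)"] by (simp add: heavy_mon_def lookup_add)
  moreover have "lookup v (i, j) > 0"
    using ij assms(4)[of "(i, j)"] by simp
  ultimately show ?thesis
    using linked_shared linked_conn u' by blast
qed

section \<open>Following a path through two multigraphs of equal degrees\<close>

lemma add_single_le:
  assumes "\<And>x. lookup m x \<le> lookup (u::mon) x" "lookup m e = 0" "c \<le> lookup u e"
  shows "lookup (m + single e c) x \<le> lookup u x"
  using assms by (cases "x = e") (simp_all add: lookup_add lookup_single when_def)

lemma light_mon_le:
  assumes "\<And>x. lookup (light_part t s) x \<le> lookup u x" 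
    and "lookup u (path_end t s, path_end t s + 1) > 0" "lookup u (path_end t s, path_end t s + 2) > 0"
  shows "lookup (light_mon t s) x \<le> lookup u x"
  unfolding light_mon_def
  using assms(2,3) parts_support(2)[of t s "path_end t s"]
  by (intro add_single_le assms(1)) (auto simp: lookup_add lookup_single Suc_le_eq)

lemma heavy_mon_le:
  assumes "\<And>x. lookup (heavy_part t s) x \<le> lookup u x" 
    and "lookup u (path_end t s + 1, path_end t s + 2) > 0"
  shows "lookup (heavy_mon t s) x \<le> lookup u x"
  unfolding heavy_mon_def
  using assms(2) parts_support(1)[of t s "path_end t s + 1"]
  by (intro add_single_le assms(1)) (auto simp: Suc_le_eq)

text \<open>Let \<open>k\<close> be the path end. If the light part has a short edge
  \<open>(k - 3, k - 2)\<close>, a quadric in \<open>v\<close> produces the last path edge of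
  \<open>u\<close>. The only other case is a last step 1, where the argument returns to the previous
  path end.\<close>

lemma linked_backward:
  assumes s: "set s \<subseteq> {1, 2}" and ku: "keys u \<subseteq> Eset" and kv: "keys v \<subseteq> Eset"
    and deg: "\<And>n. vdeg u n = vdeg v n"
    and hu: "\<And>x. lookup (heavy_part t s) x \<le> lookup u x"
    and lv: "\<And>x. lookup (light_part t s) x \<le> lookup v x"
    and backward: "lookup v (path_end t s - 1, path_end t s) > 0"
  shows "linked u v"
proof -
  define k where "k = path_end t s"
  have u_last: "lookup u (k - 2, k) \<ge> 2"
    using heavy_part_last[of t s] hu[of "(k - 2, k)"] by (simp add: k_def)
  \<comment> \<open>The quadric turns \<open>(q, q + 1)\<close> and \<open>(q + 2, q + 3)\<close>
    into long edges, the second of which is \<open>(k - 2, k)\<close>.\<close>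
  have from_short: "linked u v" if q: "lookup v (q, q + 1) > 0" "k = q + 3" for q
  proof -
    have "lookup v (q + 2, q + 3) > 0"
      using backward q(2) by (simp add: k_def[symmetric])
    then obtain v' where "conn v v'" "lookup v' (q + 1, q + 3) > 0"
      using quad_short_to_long[OF kv q(1)] by blast
    then show ?thesis
      using u_last q(2) linked_shared[of v' "q + 1" "q + 3" u] linked_conn linked_sym
      by fastforce
  qed
  show ?thesis
  proof (cases s)
    case Nil
    then show ?thesis
      using from_short[of "t + 2"] lv[of "(t + 2, t + 3)"]
      by (simp add: k_def lookup_add lookup_single numeral_eq_Suc)
  next
    case (Cons a s')
    define k' where "k' = path_end t s'"
    have s': "set s' \<subseteq> {1, 2}"
      using s Cons by auto
    show ?thesis
    proof (cases "a = 1")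
      case False
      then show ?thesis
        using from_short[of k'] lv[of "(k', k' + 1)"] Cons
        by (simp add: k_def k'_def lookup_add lookup_single)
    next
      case True
      then have k: "k = k' + 2"
        using Cons by (simp add: k_def k'_def)
      have k'5: "k' \<ge> 5"
        using path_end_ge[of t s'] by (simp add: k'_def)
      have hu': "lookup (light_part t s' + edge2 k' (k' + 2)) x \<le> lookup u x" for x
        using hu[of x] True Cons by (simp add: k'_def)
      have lu': "lookup (light_part t s') x \<le> lookup u x" for x
        using hu'[of x] by (simp add: lookup_add)
      have hv': "lookup (heavy_part t s') x \<le> lookup v x" for x
        using lv[of x] True Cons by simp
      have vk: "lookup v (k' + 1, k' + 2) > 0"
        using backward by (simp add: k_def[symmetric] k)
      have uk: "lookup u (k', k' + 2) \<ge> 2"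
        using u_last k by simp
      \<comment> \<open>Before the last step 1 the roles were exchanged: \<open>u\<close> contains
        the light and \<open>v\<close> the heavy part of \<open>s'\<close>. Two edges at
        \<open>k'\<close> therefore complete a light monomial.\<close>
      have close: ?thesis if "conn u w" "keys w \<subseteq> Eset"
        "\<And>x. lookup (light_part t s') x \<le> lookup w x"
        "lookup w (k', k' + 1) > 0" "lookup w (k', k' + 2) > 0" for w
        using linked_light[OF s' that(2) light_mon_le[OF that(3)] hv'] that(1,4,5) linked_conn
        by (simp add: k'_def)
      \<comment> \<open>The edge of \<open>v\<close> at \<open>k' + 1\<close> forces an edge of
        \<open>u\<close> at this vertex; each of the four candidates leads to a link.\<close>
      have "vdeg v (k' + 1) > 0"
        using vk vdeg_eq[OF kv, of "k' + 1"] by simp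
      then have "lookup u (k' - 1, k' + 1) > 0 \<or> lookup u (k', k' + 1) > 0
          \<or> lookup u (k' + 1, k' + 2) > 0 \<or> lookup u (k' + 1, k' + 3) > 0"
        using deg[of "k' + 1"] vdeg_eq[OF ku, of "k' + 1"] by (simp add: numeral_eq_Suc)
      then consider "lookup u (k' - 1, k' + 1) > 0" | "lookup u (k', k' + 1) > 0"
        | "lookup u (k' + 1, k' + 2) > 0" | "lookup u (k' + 1, k' + 3) > 0" by linarith
      then show ?thesis
      proof cases
        case 1
        have k'_eqs: "k' - 1 + 1 = k'" "k' - 1 + 2 = k' + 1" "k' - 1 + 3 = k' + 2"
          using k'5 by simp_all
        have "lookup u (k' - 1, k' - 1 + 2) > 0" "lookup u (k' - 1 + 1, k' - 1 + 3) > 0"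
          using 1 uk unfolding k'_eqs by simp_all
        then obtain u' where "conn u u'" "lookup u' (k' + 1, k' + 2) > 0"
          using quad_long_to_short[OF ku] unfolding k'_eqs by (metis k'_eqs)
        then show ?thesis
          using linked_shared vk linked_conn by blast
      next
        case 2
        then show ?thesis
          using close[OF conn.refl ku lu'] uk by simp
      next
        case 3
        then show ?thesis
          using linked_shared vk by blast
      next
        case 4
        \<comment> \<open>The quadric creates \<open>(k', k' + 1)\<close> and consumes one copy of
          the doubled edge \<open>(k', k' + 2)\<close>; the other copy completes the
          triangle.\<close>
        obtain u' where u': "conn u u'" "keys u' \<subseteq> Eset" "lookup u' (k', k' + 1) > 0"
          and "lookup u' (k' + 2, k' + 3) > 0"
          and le: "\<forall>x. x \<noteq> (k' + 1, k' + 3) \<longrightarrow> lookup u x \<le> lookup u' x + (if x = (k', k' + 2) then 1 else 0)"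
          by (rule quad_long_to_short[OF ku less_le_trans[OF zero_less_numeral uk] 4])
        have "lookup (light_part t s') x \<le> lookup u' x" for x
        proof (cases x)
          case (Pair i j)
          then show ?thesis
            using parts_support(2)[of t s' i j] lu'[of x] le[rule_format, of x]
            by (cases "lookup (light_part t s') (i, j) = 0") (auto simp: k'_def)
        qed
        moreover have "lookup u' (k', k' + 2) > 0"
          using le[rule_format, of "(k', k' + 2)"] uk by simp
        ultimately show ?thesis
          using close u' by blast
      qed
    qed
  qed
qed

text \<open>The degree of \<open>u\<close> at the path end \<open>k\<close> is at least 2, hence
  also that of \<open>v\<close>. The edges of \<open>v\<close> at \<open>k\<close> then give a link,
  close the triangle or prolong the path, and the path cannot reach \<open>N\<close>.\<close>

lemma linked_of_parts:
  assumes "set s \<subseteq> {1, 2}" "keys u \<subseteq> Eset" "keys v \<subseteq> Eset"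
    and "\<And>n. vdeg u n = vdeg v n" "\<And>n. n \<ge> N \<Longrightarrow> vdeg u n = 0"
    and "\<And>x. lookup (heavy_part t s) x \<le> lookup u x"
    and "\<And>x. lookup (light_part t s) x \<le> lookup v x"
  shows "linked u v"
  using assms
proof (induction "N - path_end t s" arbitrary: s u v rule: less_induct)
  case less
  note s = less.prems(1) and ku = less.prems(2) and kv = less.prems(3) and deg = less.prems(4)
    and bound = less.prems(5) and hu = less.prems(6) and lv = less.prems(7)
  define k where "k = path_end t s"
  have k5: "k \<ge> 5"
    using path_end_ge[of t s] by (simp add: k_def)
  have u_last: "lookup u (k - 2, k) \<ge> 2"
    using heavy_part_last[of t s] hu[of "(k - 2, k)"] by (simp add: k_def)
  then have uk: "vdeg u k \<ge> 2"
    using vdeg_eq[OF ku, of k] by simp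
  then have kN: "k < N"
    using bound[of k] by (cases "k < N") auto
  have vk: "lookup v (k - 2, k) + lookup v (k - 1, k) + lookup v (k, k + 1) + lookup v (k, k + 2) \<ge> 2"
    using uk deg[of k] vdeg_eq[OF kv, of k] by simp
  consider "lookup v (k - 2, k) > 0" | "lookup v (k - 1, k) > 0"
    | "lookup v (k, k + 1) > 0" "lookup v (k, k + 2) > 0"
    | "lookup v (k, k + 2) \<ge> 2" | "lookup v (k, k + 1) \<ge> 2"
    using vk by linarith
  then show ?case
  proof cases
    case 1
    then show ?thesis
      using u_last linked_shared[of u "k - 2" k v] by simp
  next
    case 2
    then show ?thesis
      using linked_backward[OF s ku kv deg hu lv] by (simp add: k_def)
  next
    case 3
    then show ?thesis
      using linked_light[OF s kv light_mon_le[OF lv] hu] linked_sym by (simp add: k_def)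
  next
    case 4
    \<comment> \<open>Step 1: the doubled edge makes \<open>v\<close> the heavy side, so
      \<open>u\<close> and \<open>v\<close> exchange roles.\<close>
    have "lookup (heavy_part t (1 # s)) x \<le> lookup v x" for x
      using add_single_le[OF lv, of "(k, k + 2)" 2 x] 4 parts_support(2)[of t s k "k + 2"]
      by (auto simp: k_def)
    moreover have "lookup (light_part t (1 # s)) x \<le> lookup u x" for x
      using hu by simp
    moreover have "vdeg v n = 0" if "n \<ge> N" for n
      using bound[OF that] deg by simp
    ultimately have "linked v u"
      using less.hyps[of "1 # s" v u] s ku kv deg kN by (simp add: k_def)
    then show ?thesis by (rule linked_sym)
  next
    case 5
    \<comment> \<open>The doubled edge \<open>(k, k + 1)\<close> of \<open>v\<close> has to be
      matched by \<open>u\<close> at \<open>k + 1\<close>. Only a doubled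
      \<open>(k + 1, k + 3)\<close> gives no immediate link, and this is step 2.\<close>
    have "vdeg v (k + 1) \<ge> 2"
      using 5 vdeg_eq[OF kv, of "k + 1"] by simp
    then have "lookup u (k - 1, k + 1) + lookup u (k, k + 1)
        + lookup u (k + 1, k + 2) + lookup u (k + 1, k + 3) \<ge> 2"
      using deg[of "k + 1"] vdeg_eq[OF ku, of "k + 1"] by (simp add: numeral_eq_Suc)
    then consider "lookup u (k - 1, k + 1) > 0" | "lookup u (k, k + 1) > 0"
      | "lookup u (k + 1, k + 2) > 0" | "lookup u (k + 1, k + 3) \<ge> 2"
      by linarith
    then show ?thesis
    proof cases
      case 1
      \<comment> \<open>The quadric at \<open>k - 2\<close> turns \<open>(k - 2, k)\<close> and
        \<open>(k - 1, k + 1)\<close> into short edges, one of them \<open>(k, k + 1)\<close>, which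
        \<open>v\<close> has.\<close>
      have k_eqs: "k - 2 + 1 = k - 1" "k - 2 + 2 = k" "k - 2 + 3 = k + 1"
        using k5 by simp_all
      have "lookup u (k - 2, k - 2 + 2) > 0" "lookup u (k - 2 + 1, k - 2 + 3) > 0"
        using u_last 1 unfolding k_eqs by simp_all
      then obtain u' where "conn u u'" "lookup u' (k - 2 + 2, k - 2 + 3) > 0"
        using quad_long_to_short[OF ku] by blast
      then have "linked u' v"
        using linked_shared[of u' k "k + 1" v] 5 unfolding k_eqs by simp
      then show ?thesis
        using linked_conn \<open>conn u u'\<close> by blast
    next
      case 2
      then show ?thesis
        using linked_shared[of u k "k + 1" v] 5 by simp
    next
      case 3
      then show ?thesis
        using linked_heavy[OF s ku heavy_mon_le[OF hu] lv] by (simp add: k_def)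
    next
      case 4
      have "lookup (heavy_part t (2 # s)) x \<le> lookup u x" for x
        using add_single_le[OF hu, of "(k + 1, k + 3)" 2 x] 4 parts_support(1)[of t s "k + 1" "k + 3"]
        by (auto simp: k_def)
      moreover have "lookup (light_part t (2 # s)) x \<le> lookup v x" for x
        using add_single_le[OF lv, of "(k, k + 1)" 2 x] 5 parts_support(2)[of t s k "k + 1"]
        by (auto simp: k_def)
      ultimately show ?thesis
        using less.hyps[of "2 # s" u v] s ku kv deg bound kN by (simp add: k_def)
    qed
  qed
qed

section \<open>Starting a walk at the lowest vertex\<close>

lemma finite_vdeg: "\<exists>N. \<forall>n\<ge>N. vdeg u n = 0"
proof -
  obtain N where "\<forall>n\<in>keys (phi_mon u). n < N"
    using finite_nat_set_iff_bounded finite_keys by metis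
  then have "\<forall>n\<ge>N. vdeg u n = 0"
    unfolding vdeg_def by (metis in_keys_iff leD)
  then show ?thesis ..
qed

text \<open>The degree balances \<open>e0\<close>, \<open>e1\<close>, \<open>e2\<close> at the three
  lowest vertices leave a quadric on \<open>v\<close>, a quadric on \<open>u\<close>, or the first
  triangle and path edge of a walk.\<close>

lemma linked_at_bottom:
  assumes ku: "keys u \<subseteq> Eset" and kv: "keys v \<subseteq> Eset" and deg: "\<And>n. vdeg u n = vdeg v n"
    and n: "n \<ge> 1" and u1: "lookup u (n, n + 1) > 0" and v2: "lookup v (n, n + 2) > 0"
    and below: "\<And>i. i < n \<Longrightarrow> vdeg u i = 0"
  shows "linked u v"
proof (cases "lookup u (n, n + 2) > 0 \<or> lookup v (n, n + 1) > 0")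
  case True
  then show ?thesis using linked_shared u1 v2 by blast
next
  case False
  then have u2: "lookup u (n, n + 2) = 0" and v1: "lookup v (n, n + 1) = 0" by auto
  have zero: "lookup u (i, j) = 0 \<and> lookup v (i, j) = 0" if "i < n" for i j
    using below[OF that] deg[of i] vdeg_eq_0_lookup[OF ku, of i j] vdeg_eq_0_lookup[OF kv, of i j]
    by simp
  have z: "n - 1 < n" "n - 2 < n" using n by auto
  have e0: "lookup u (n, n + 1) = lookup v (n, n + 2)"
    using deg[of n] vdeg_eq[OF ku, of n] vdeg_eq[OF kv, of n] zero[OF z(1)] zero[OF z(2)] u2 v1
    by simp
  have e1: "lookup u (n, n + 1) + lookup u (n + 1, n + 2) + lookup u (n + 1, n + 3)
      = lookup v (n + 1, n + 2) + lookup v (n + 1, n + 3)"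
    using deg[of "n + 1"] vdeg_eq[OF ku, of "n + 1"] vdeg_eq[OF kv, of "n + 1"] zero[OF z(1)] v1
    by (simp add: numeral_eq_Suc)
  have e2: "lookup u (n + 1, n + 2) + lookup u (n + 2, n + 3) + lookup u (n + 2, n + 4)
      = lookup v (n, n + 2) + lookup v (n + 1, n + 2) + lookup v (n + 2, n + 3) + lookup v (n + 2, n + 4)"
    using deg[of "n + 2"] vdeg_eq[OF ku, of "n + 2"] vdeg_eq[OF kv, of "n + 2"] u2
    by (simp add: numeral_eq_Suc)
  consider "lookup v (n + 1, n + 3) > 0" | "lookup u (n + 2, n + 3) > 0"
    | "lookup v (n + 1, n + 3) = 0" "lookup u (n + 2, n + 3) = 0" by blast
  then show ?thesis
  proof cases
    case 1
    then obtain v' where "conn v v'" "lookup v' (n, n + 1) > 0"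
      using quad_long_to_short[OF kv v2] by blast
    then show ?thesis
      using linked_shared u1 linked_conn linked_sym by blast
  next
    case 2
    then obtain u' where "conn u u'" "lookup u' (n, n + 2) > 0"
      using quad_short_to_long[OF ku u1] by blast
    then show ?thesis
      using linked_shared v2 linked_conn by blast
  next
    case 3
    \<comment> \<open>By \<open>e1\<close> the exponent of \<open>(n + 1, n + 2)\<close> in
      \<open>v\<close> exceeds that in \<open>u\<close> by at least 1. Together with the edge
      \<open>(n, n + 2)\<close> of \<open>v\<close>, \<open>e2\<close> then leaves at least 2 for
      \<open>(n + 2, n + 4)\<close> in \<open>u\<close>.\<close>
    then have u4: "lookup u (n + 2, n + 4) \<ge> 2" and v3: "lookup v (n + 1, n + 2) \<ge> 1"
      using e0 e1 e2 u1 by linarith+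
    have n_eqs: "n - 1 + 1 = n" "n - 1 + 2 = n + 1" "n - 1 + 3 = n + 2" "n - 1 + 5 = n + 4"
      using n by simp_all
    have "lookup (0 + edge n (n + 1) + edge2 (n + 2) (n + 4)) x \<le> lookup u x" for x
      using u1 u4 by (intro add_single_le) (simp_all add: lookup_single)
    then have "lookup (heavy_part (n - 1) []) x \<le> lookup u x" for x
      unfolding heavy_part.simps n_eqs by simp
    moreover have "lookup (0 + edge n (n + 2) + edge (n + 1) (n + 2)) x \<le> lookup v x" for x
      using v2 v3 by (intro add_single_le) (simp_all add: lookup_single)
    then have "lookup (light_part (n - 1) []) x \<le> lookup v x" for x
      unfolding light_part.simps n_eqs by simp
    moreover obtain N where "\<And>i. i \<ge> N \<Longrightarrow> vdeg u i = 0"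
      using finite_vdeg[of u] by blast
    ultimately show ?thesis
      by (intro linked_of_parts[of "[]" u v N "n - 1"] ku kv deg) auto
  qed
qed

lemma linked_fiber:
  assumes ku: "keys u \<subseteq> Eset" and kv: "keys v \<subseteq> Eset" and deg: "\<And>n. vdeg u n = vdeg v n"
    and "u \<noteq> 0"
  shows "linked u v"
proof -
  obtain i j where "lookup u (i, j) > 0"
    using \<open>u \<noteq> 0\<close> by (metis gr0I lookup_zero poly_mapping_eqI surj_pair)
  then have ex: "\<exists>n. vdeg u n > 0"
    using vdeg_eq_0_lookup[OF ku] by (metis gr0I less_numeral_extra(3))
  define n where "n = (LEAST n. vdeg u n > 0)"
  have below: "vdeg u i = 0" if "i < n" for i
    using not_less_Least[of i "\<lambda>n. vdeg u n > 0"] that by (simp add: n_def)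
  have un: "vdeg u n > 0" using LeastI_ex[OF ex] by (simp add: n_def)
  then have n: "n \<ge> 1"
    using vdeg_0_eq_0[OF ku] by (cases n) auto
  have zero: "lookup u (i, n) = 0 \<and> lookup v (i, n) = 0" if "i < n" for i
    using below[OF that] deg[of i] vdeg_eq_0_lookup[OF ku, of i n] vdeg_eq_0_lookup[OF kv, of i n]
    by simp
  have z: "n - 1 < n" "n - 2 < n" using n by auto
  have "lookup u (n, n + 1) > 0 \<or> lookup u (n, n + 2) > 0"
    using un vdeg_eq[OF ku, of n] zero[OF z(1)] zero[OF z(2)] by simp
  moreover have "lookup v (n, n + 1) > 0 \<or> lookup v (n, n + 2) > 0"
    using un deg[of n] vdeg_eq[OF kv, of n] zero[OF z(1)] zero[OF z(2)] by simp
  moreover have "linked u v" if "lookup u (n, n + 1) > 0" "lookup v (n, n + 2) > 0"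
    using linked_at_bottom[OF ku kv deg n that below] .
  moreover have "linked u v" if "lookup v (n, n + 1) > 0" "lookup u (n, n + 2) > 0"
    using linked_at_bottom[OF kv ku deg[symmetric] n that] below deg linked_sym by simp
  ultimately show ?thesis
    using linked_shared by blast
qed

text \<open>Induction on the total degree: cancelling the edge shared after linking lowers it, and
  the rule \<open>add\<close> multiplies that edge back.\<close>

theorem conn_fiber:
  assumes "keys u \<subseteq> Eset" "keys v \<subseteq> Eset" "\<And>n. vdeg u n = vdeg v n"
  shows "conn u v"
  using assms
proof (induction "\<Sum>n\<in>keys (phi_mon u). vdeg u n" arbitrary: u v rule: less_induct)
  case less
  show ?case
  proof (cases "u = 0")
    case True
    then have "v = 0"
      using less.prems(2,3) by (intro vdeg_all_0_imp_0) (simp_all flip: less.prems(3))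
    then show ?thesis using True conn.refl by simp
  next
    case False
    then obtain i j u' v' where cu: "conn u (edge i j + u')" and cv: "conn v (edge i j + v')"
      using linked_fiber[OF less.prems] unfolding linked_def by blast
    have ku: "keys u' \<subseteq> Eset" "keys (edge i j) \<subseteq> Eset" and kv: "keys v' \<subseteq> Eset"
      using conn_keys[OF cu] conn_keys[OF cv] less.prems by (simp_all add: keys_add_Eset)
    have deg: "vdeg u' n = vdeg v' n" for n
      using conn_vdeg[OF cu, of n] conn_vdeg[OF cv, of n] less.prems(3)[of n] by simp
    have du: "vdeg u n = vdeg (edge i j) n + vdeg u' n" for n
      using conn_vdeg[OF cu] by simp
    \<comment> \<open>Enlarging the index set to \<open>keys (phi_mon u)\<close> allows a termwise
      comparison, strict at the endpoint \<open>i\<close> of the cancelled edge.\<close>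
    have "(\<Sum>n\<in>keys (phi_mon u'). vdeg u' n) \<le> (\<Sum>n\<in>keys (phi_mon u). vdeg u' n)"
      using du by (intro sum_mono2) (auto simp: in_keys_iff vdeg_def[symmetric])
    also have "\<dots> < (\<Sum>n\<in>keys (phi_mon u). vdeg u n)"
    proof (rule sum_strict_mono_ex1)
      show "\<exists>n\<in>keys (phi_mon u). vdeg u' n < vdeg u n"
        using du[of i] by (intro bexI[of _ i]) (auto simp: in_keys_iff vdeg_def[symmetric])
    qed (use du in auto)
    finally have "conn u' v'"
      using less.hyps ku kv deg by blast
    then have "conn (edge i j + u') (edge i j + v')"
      using conn.add ku by (metis add.commute)
    then show ?thesis
      using cu cv conn.trans conn.sym by blast
  qed
qed

subsection \<open>The generators as explicit binomials\<close>

text \<open>Parity of the number of steps 1. Such a step keeps the initial weights but exchanges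
  heavy and light, so the parity tells which of the two is the positive monomial.\<close>

fun flipped :: "nat list \<Rightarrow> bool" where
  "flipped [] = False"
| "flipped (a # s) = (if a = 1 then \<not> flipped s else flipped s)"

definition gen_pos :: "nat list \<Rightarrow> mon" where
  "gen_pos s = (if flipped s then light_mon 0 s else heavy_mon 0 s)"

definition gen_neg :: "nat list \<Rightarrow> mon" where
  "gen_neg s = (if flipped s then heavy_mon 0 s else light_mon 0 s)"

section \<open>Coprimality and weights along the recursion\<close>

lemma parts_disjoint: "lookup (heavy_part t s) x = 0 \<or> lookup (light_part t s) x = 0"
proof (induction s)
  case Nil
  show ?case by (cases x) (auto simp: lookup_add lookup_single when_def)
next
  case (Cons a s)
  obtain i j where x: "x = (i, j)" by (cases x)
  show ?case
    using Cons path_end_ge[of t s]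
    by (cases "a = 1") (auto simp: x heavy_part_eq_0 light_part_eq_0 lookup_add lookup_single when_def)
qed

lemma mons_disjoint: "lookup (heavy_mon t s) x = 0 \<or> lookup (light_mon t s) x = 0"
proof -
  obtain i j where x: "x = (i, j)" by (cases x)
  show ?thesis
    using parts_disjoint[of t s x]
    by (auto simp: x heavy_part_eq_0 light_part_eq_0 heavy_mon_def light_mon_def lookup_add lookup_single when_def)
qed

text \<open>The support bounds separate the parts from the last triangle. Written relative to the
  path end, the weight can be compared with the cases of \<open>step1\<close> and
  \<open>step2\<close>.\<close>

lemma weight_cases:
  fixes t s
  defines "k \<equiv> path_end t s"
  shows "weight (heavy_mon t s) (light_mon t s) (i, j) =
    (if i + 2 \<le> k \<and> j \<le> k then int (lookup (heavy_part t s) (i, j)) - int (lookup (light_part t s) (i, j))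
     else if (i, j) = (k + 1, k + 2) then 1
     else if (i, j) = (k, k + 1) \<or> (i, j) = (k, k + 2) then -1 else 0)"
  by (auto simp: k_def heavy_part_eq_0 light_part_eq_0 weight_def heavy_mon_def light_mon_def lookup_add lookup_single when_def)

text \<open>The top edge of the last triangle has weight \<open>c\<close>. All thresholds of the
  recursion are thus offset by 2 from the path end; the factor \<open>c\<close> covers both
  signs.\<close>

lemma maxvert_heavy_light:
  assumes "\<And>e. w e = c * weight (heavy_mon t s) (light_mon t s) e" and "c \<noteq> 0"
  shows "maxvert w = path_end t s + 2"
  unfolding maxvert_def
proof (rule Max_eqI)
  let ?V = "{n. \<exists>e\<in>Eset. w e \<noteq> 0 \<and> (n = fst e \<or> n = snd e)}"
  show le: "n \<le> path_end t s + 2" if n: "n \<in> ?V" for n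
  proof -
    obtain i j where e: "w (i, j) \<noteq> 0" "n = i \<or> n = j" using n by auto
    then show ?thesis
      by (auto simp: assms(1) weight_cases split: if_splits)
  qed
  show "finite ?V"
    by (rule finite_subset[of _ "{..path_end t s + 2}"]) (use le in blast, simp)
  have "w (path_end t s + 1, path_end t s + 2) \<noteq> 0"
    using assms(2) by (simp add: assms(1) weight_cases)
  then show "path_end t s + 2 \<in> ?V"
    by (auto simp: Eset_iff intro!: bexI[of _ "(path_end t s + 1, path_end t s + 2)"])
qed

text \<open>The initial weights stay while heavy and light exchange names, which accounts for the
  sign of \<open>c\<close>.\<close>

lemma weight_step1:
  assumes w: "\<And>e. w e = c * weight (heavy_mon t s) (light_mon t s) e" and "c \<noteq> 0"
  shows "step1 w (i, j) = - c * weight (heavy_mon t (1 # s)) (light_mon t (1 # s)) (i, j)"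
proof (cases "(i, j) \<in> Eset")
  case False
  then show ?thesis
    using lookup_outside_Eset[OF keys_heavy_mon False] lookup_outside_Eset[OF keys_light_mon False]
    by (simp add: step1_def weight_def)
next
  case E: True
  define k where "k = path_end t s"
  have k: "maxvert w = k + 2"
    using maxvert_heavy_light[of w, OF w \<open>c \<noteq> 0\<close>] by (simp add: k_def)
  have k5: "k \<ge> 5" using path_end_ge[of t s] by (simp add: k_def)
  have "step1 w (i, j) = (if i + 2 \<le> k \<and> j \<le> k then w (i, j)
     else if (i, j) = (k, k + 2) then 2 * w (i, j)
     else if k + 2 \<le> i \<and> k + 3 \<le> j then - w (i - 2, j - 2)
     else 0)"
    using E k5 by (auto simp: step1_def k le_E_def Let_def)
  also have "\<dots> = - c * weight (heavy_mon t (1 # s)) (light_mon t (1 # s)) (i, j)"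
  proof (cases "i + 2 \<le> k \<and> j \<le> k")
    case True
    then show ?thesis
      unfolding w weight_cases k_def[symmetric]
      by (simp add: k_def[symmetric] lookup_add lookup_single algebra_simps)
  next
    case False
    have zero: "lookup (heavy_part t s) (i, j) = 0" "lookup (light_part t s) (i, j) = 0"
      using False by (auto intro!: heavy_part_eq_0 light_part_eq_0 simp: k_def)
    have "i + 1 \<ge> k"
      using E False by (auto simp: Eset_iff)
    \<comment> \<open>The form \<open>i = k + 4 + d\<close> covers the edges beyond the new last
      triangle, where both sides vanish, without subtraction.\<close>
    define d where "d = i - k - 4"
    consider "i + 1 = k" | "i = k" | "i = k + 1" | "i = k + 2" | "i = k + 3" | "i = k + 4 + d"
      using \<open>i + 1 \<ge> k\<close> unfolding d_def by linarith
    moreover have "j = i + 1 \<or> j = i + 2"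
      using E by (simp add: Eset_iff)
    ultimately show ?thesis
      using zero unfolding w weight_cases k_def[symmetric]
      by cases (auto simp: lookup_add lookup_single k_def[symmetric])
  qed
  finally show ?thesis .
qed

text \<open>Heavy and light keep their names. As \<open>(k, k + 1)\<close> has weight
  \<open>- c\<close>, the value prescribed at \<open>(k + 1, k + 3)\<close> is \<open>2 * c\<close>,
  a doubled edge on the heavy side.\<close>

lemma weight_step2:
  assumes w: "\<And>e. w e = c * weight (heavy_mon t s) (light_mon t s) e" and "c \<noteq> 0"
  shows "step2 w (i, j) = c * weight (heavy_mon t (2 # s)) (light_mon t (2 # s)) (i, j)"
proof (cases "(i, j) \<in> Eset")
  case False
  then show ?thesis
    using lookup_outside_Eset[OF keys_heavy_mon False] lookup_outside_Eset[OF keys_light_mon False]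
    by (simp add: step2_def weight_def)
next
  case E: True
  define k where "k = path_end t s"
  have k: "maxvert w = k + 2"
    using maxvert_heavy_light[of w, OF w \<open>c \<noteq> 0\<close>] by (simp add: k_def)
  have k5: "k \<ge> 5" using path_end_ge[of t s] by (simp add: k_def)
  have "step2 w (i, j) = (if i + 2 \<le> k \<and> j \<le> k then w (i, j)
     else if (i, j) = (k, k + 1) then 2 * w (i, j)
     else if (i, j) = (k + 1, k + 3) then - 2 * w (k, k + 1)
     else if k + 3 \<le> i \<and> k + 4 \<le> j then w (i - 3, j - 3)
     else 0)"
    using E k5 by (auto simp: step2_def k le_E_def Let_def)
  also have "\<dots> = c * weight (heavy_mon t (2 # s)) (light_mon t (2 # s)) (i, j)"
  proof (cases "i + 2 \<le> k \<and> j \<le> k")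
    case True
    then show ?thesis
      unfolding w weight_cases k_def[symmetric]
      by (simp add: k_def[symmetric] lookup_add lookup_single algebra_simps)
  next
    case False
    have zero: "lookup (heavy_part t s) (i, j) = 0" "lookup (light_part t s) (i, j) = 0"
      using False by (auto intro!: heavy_part_eq_0 light_part_eq_0 simp: k_def)
    have "i + 1 \<ge> k"
      using E False by (auto simp: Eset_iff)
    define d where "d = i - k - 5"
    consider "i + 1 = k" | "i = k" | "i = k + 1" | "i = k + 2" | "i = k + 3" | "i = k + 4" | "i = k + 5 + d"
      using \<open>i + 1 \<ge> k\<close> unfolding d_def by linarith
    moreover have "j = i + 1 \<or> j = i + 2"
      using E by (simp add: Eset_iff)
    ultimately show ?thesis
      using zero unfolding w weight_cases k_def[symmetric]
      by cases (auto simp: lookup_add lookup_single k_def[symmetric])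
  qed
  finally show ?thesis .
qed

lemma wseq_rev_eq:
  assumes "set s \<subseteq> {1, 2}"
  shows "wseq_rev s e = (if flipped s then -1 else 1) * weight (heavy_mon 0 s) (light_mon 0 s) e"
  using assms
proof (induction s arbitrary: e)
  case Nil
  show ?case
    by (simp add: u0_def v0_def heavy_mon_def light_mon_def weight_def lookup_add numeral_eq_Suc)
next
  case (Cons a s)
  obtain i j where e: "e = (i, j)" by (cases e)
  have w: "wseq_rev s e = (if flipped s then -1 else 1) * weight (heavy_mon 0 s) (light_mon 0 s) e" for e
    using Cons by simp
  show ?case
    using Cons.prems weight_step1[of "wseq_rev s", OF w, of i j] weight_step2[of "wseq_rev s", OF w, of i j]
    by (auto simp: e)
qed

lemma wseq_rev_weight: "set s \<subseteq> {1, 2} \<Longrightarrow> wseq_rev s = weight (gen_pos s) (gen_neg s)"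
  by (rule ext) (simp add: wseq_rev_eq gen_pos_def gen_neg_def weight_def)

text \<open>Coprimality allows both monomials to be recovered from the difference of their
  exponents.\<close>

lemma binom_weight:
  assumes "keys u \<subseteq> Eset" "keys v \<subseteq> Eset" "\<And>x. lookup u x = 0 \<or> lookup v x = 0"
  shows "binom (weight u v) = single u 1 - single v 1"
proof -
  have fin: "finite {e \<in> Eset. weight u v e \<noteq> 0}"
    by (rule finite_subset[of _ "keys u \<union> keys v"]) (auto simp: weight_def in_keys_iff)
  have outside: "lookup u x = 0" "lookup v x = 0" if "x \<notin> Eset" for x
    using assms(1,2) that by (metis in_keys_iff subsetD)+
  have "pos_mon (weight u v) = u"
  proof (rule poly_mapping_eqI)
    fix x
    have "lookup (pos_mon (weight u v)) x =
       (\<Sum>e\<in>{e \<in> Eset. weight u v e \<noteq> 0}. if e = x then nat (max (weight u v x) 0) else 0)"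
      unfolding pos_mon_def lookup_sum by (rule sum.cong) (auto simp: lookup_single when_def)
    also have "\<dots> = lookup u x"
      using fin assms(3)[of x] outside[of x] by (auto simp: weight_def)
    finally show "lookup (pos_mon (weight u v)) x = lookup u x" .
  qed
  moreover have "neg_mon (weight u v) = v"
  proof (rule poly_mapping_eqI)
    fix x
    have "lookup (neg_mon (weight u v)) x =
       (\<Sum>e\<in>{e \<in> Eset. weight u v e \<noteq> 0}. if e = x then nat (max (- weight u v x) 0) else 0)"
      unfolding neg_mon_def lookup_sum by (rule sum.cong) (auto simp: lookup_single when_def)
    also have "\<dots> = lookup v x"
      using fin assms(3)[of x] outside[of x] by (auto simp: weight_def)
    finally show "lookup (neg_mon (weight u v)) x = lookup v x" .
  qed
  ultimately show ?thesis by (simp add: binom_def)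
qed

lemma keys_gen: "keys (gen_pos s) \<subseteq> Eset" "keys (gen_neg s) \<subseteq> Eset"
  by (simp_all add: gen_pos_def gen_neg_def keys_heavy_mon keys_light_mon)

lemma gen_disjoint: "lookup (gen_pos s) x = 0 \<or> lookup (gen_neg s) x = 0"
  using mons_disjoint[of 0 s x] by (auto simp: gen_pos_def gen_neg_def)

lemma vdeg_gen: "vdeg (gen_pos s) n = vdeg (gen_neg s) n"
  by (simp add: gen_pos_def gen_neg_def vdeg_mons)

lemma gs_eq:
  assumes "set s \<subseteq> {1, 2}"
  shows "gs s = single (gen_pos (rev s)) 1 - single (gen_neg (rev s)) 1"
proof (cases "s = []")
  case True
  then show ?thesis
    by (simp add: gs_def g_empty_def gen_pos_def gen_neg_def heavy_mon_def light_mon_def u0_def v0_def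
        numeral_eq_Suc ac_simps)
next
  case False
  have "binom (wseq_rev (rev s)) = single (gen_pos (rev s)) 1 - single (gen_neg (rev s)) 1"
    using assms by (simp add: wseq_rev_weight binom_weight keys_gen gen_disjoint)
  then show ?thesis using False by (simp add: gs_def)
qed

lemma g2_eq: "g2 = single (edge 1 2 + edge 3 4) 1 - single (edge 1 3 + edge 2 4) 1"
  by (simp add: g2_def var_def mult_single)

text \<open>Reversal permutes the words over \<open>{1, 2}\<close>, so the same set is indexed by
  the reversed lists used from here on.\<close>

lemma G_eq:
  "(G :: 'k::field pol set) = insert (single (edge 1 2 + edge 3 4) 1 - single (edge 1 3 + edge 2 4) 1)
     {single (gen_pos s) 1 - single (gen_neg s) 1 | s. set s \<subseteq> {1, 2}}"
proof -
  have "{gs s | s. set s \<subseteq> {1, 2}} = {single (gen_pos s) 1 - single (gen_neg s) (1::'k::field) | s. set s \<subseteq> {1, 2}}"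
  proof (intro equalityI subsetI)
    fix p :: "'k pol"
    assume "p \<in> {gs s | s. set s \<subseteq> {1, 2}}"
    then obtain s where "p = gs s" "set s \<subseteq> {1, 2}" by blast
    then show "p \<in> {single (gen_pos s) 1 - single (gen_neg s) 1 | s. set s \<subseteq> {1, 2}}"
      by (intro CollectI exI[of _ "rev s"]) (simp add: gs_eq)
  next
    fix p :: "'k pol"
    assume "p \<in> {single (gen_pos s) 1 - single (gen_neg s) 1 | s. set s \<subseteq> {1, 2}}"
    then obtain s where "p = single (gen_pos s) 1 - single (gen_neg s) 1" "set s \<subseteq> {1, 2}" by blast
    then show "p \<in> {gs s | s. set s \<subseteq> {1, 2}}"
      by (intro CollectI exI[of _ "rev s"]) (simp add: gs_eq)
  qed
  then show ?thesis by (simp add: G_def g2_eq)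
qed

section \<open>Shifts of the explicit monomials\<close>

lemma path_end_shift: "path_end t s = path_end 0 s + t"
  by (induction s) auto

lemma sh_mon_parts:
  "sh_mon t (heavy_part 0 s) = heavy_part t s \<and> sh_mon t (light_part 0 s) = light_part t s"
proof (induction s)
  case Nil
  show ?case by (simp add: sh_mon_add sh_mon_single ac_simps)
next
  case (Cons a s)
  then show ?case
    by (simp add: sh_mon_add sh_mon_single path_end_shift[of t] ac_simps)
qed

lemma sh_mon_mons:
  "sh_mon t (heavy_mon 0 s) = heavy_mon t s" "sh_mon t (light_mon 0 s) = light_mon t s"
  using sh_mon_parts[of t s]
  by (simp_all add: heavy_mon_def light_mon_def sh_mon_add sh_mon_single path_end_shift[of t] ac_simps)

subsection \<open>Generation\<close>

lemma R_add: "p \<in> R \<Longrightarrow> q \<in> R \<Longrightarrow> p + q \<in> R"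
  using keys_add[of p q] by (auto simp: R_def)

lemma R_diff: "p \<in> R \<Longrightarrow> q \<in> R \<Longrightarrow> p - q \<in> R"
  using keys_diff[of p q] by (auto simp: R_def)

lemma R_zero: "0 \<in> R"
  by (simp add: R_def)

lemma R_sum: "(\<And>x. x \<in> F \<Longrightarrow> f x \<in> R) \<Longrightarrow> (\<Sum>x\<in>F. f x) \<in> R"
  by (induction F rule: infinite_finite_induct) (simp_all add: R_zero R_add)

lemma R_mult:
  assumes "p \<in> R" "q \<in> R" shows "p * q \<in> R"
proof -
  have "keys m \<subseteq> Eset" if m: "m \<in> keys (p * q)" for m
  proof -
    obtain a b where "m = a + b" "a \<in> keys p" "b \<in> keys q"
      using keys_mult[of p q] m by blast
    then show ?thesis
      using assms by (simp add: R_def keys_add_Eset)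
  qed
  then show ?thesis by (simp add: R_def)
qed

lemma single_in_R: "keys m \<subseteq> Eset \<Longrightarrow> single m c \<in> R"
  by (simp add: R_def)

lemma one_in_R: "1 \<in> R" "- 1 \<in> R"
  by (simp_all add: R_def)

lemma ideal_gen_R_gen:
  assumes "g \<in> S" "c \<in> R" shows "c * g \<in> ideal_gen_R S"
  unfolding ideal_gen_R_def using assms by (intro CollectI exI[of _ "{g}"] exI[of _ "\<lambda>_. c"]) simp

lemma ideal_gen_R_zero: "0 \<in> ideal_gen_R S"
  unfolding ideal_gen_R_def by (intro CollectI exI[of _ "{}"]) simp

lemma ideal_gen_R_add:
  assumes "p \<in> ideal_gen_R S" "q \<in> ideal_gen_R S"
  shows "p + q \<in> ideal_gen_R S"
proof -
  obtain F c where p: "p = (\<Sum>g\<in>F. c g * g)" "finite F" "F \<subseteq> S" "\<forall>g\<in>F. c g \<in> R"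
    using assms(1) unfolding ideal_gen_R_def by blast
  obtain F' c' where q: "q = (\<Sum>g\<in>F'. c' g * g)" "finite F'" "F' \<subseteq> S" "\<forall>g\<in>F'. c' g \<in> R"
    using assms(2) unfolding ideal_gen_R_def by blast
  \<comment> \<open>Both coefficient families are extended by 0 to the union of the two generator
    sets and added.\<close>
  define d where "d g = (if g \<in> F then c g else 0) + (if g \<in> F' then c' g else 0)" for g
  have "p = (\<Sum>g\<in>F \<union> F'. (if g \<in> F then c g else 0) * g)"
    unfolding p(1) using p(2) q(2) by (intro sum.mono_neutral_cong_left) auto
  moreover have "q = (\<Sum>g\<in>F \<union> F'. (if g \<in> F' then c' g else 0) * g)"
    unfolding q(1) using p(2) q(2) by (intro sum.mono_neutral_cong_left) auto
  ultimately have "p + q = (\<Sum>g\<in>F \<union> F'. d g * g)"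
    by (simp add: d_def sum.distrib[symmetric] distrib_right)
  moreover have "\<forall>g\<in>F \<union> F'. d g \<in> R"
    using p(4) q(4) by (auto simp: d_def R_zero R_add)
  ultimately show ?thesis
    unfolding ideal_gen_R_def using p(2,3) q(2,3)
    by (intro CollectI exI[of _ "F \<union> F'"] exI[of _ d]) auto
qed

lemma ideal_gen_R_sum:
  "(\<And>x. x \<in> F \<Longrightarrow> f x \<in> ideal_gen_R S) \<Longrightarrow> (\<Sum>x\<in>F. f x) \<in> ideal_gen_R S"
  by (induction F rule: infinite_finite_induct) (simp_all add: ideal_gen_R_zero ideal_gen_R_add)

lemma ideal_gen_R_mult:
  assumes "p \<in> ideal_gen_R S" "r \<in> R" shows "r * p \<in> ideal_gen_R S"
proof -
  obtain F c where p: "p = (\<Sum>g\<in>F. c g * g)" "finite F" "F \<subseteq> S" "\<forall>g\<in>F. c g \<in> R"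
    using assms(1) unfolding ideal_gen_R_def by blast
  have "r * p = (\<Sum>g\<in>F. (r * c g) * g)"
    by (simp add: p(1) sum_distrib_left mult.assoc)
  then show ?thesis
    using p(2-4) assms(2)
    by (auto intro!: ideal_gen_R_sum ideal_gen_R_gen R_mult)
qed

text \<open>Expanding \<open>c\<close> into terms yields pairs \<open>m + u\<close>,
  \<open>m + v\<close> with equal image, which cancel under \<open>phi\<close>.\<close>

lemma phi_mult_binomial:
  assumes "phi_mon u = phi_mon v"
  shows "phi (c * (single u 1 - single v 1)) = 0"
proof -
  have "c * (single u 1 - single v 1)
      = (\<Sum>m\<in>keys c. single (m + u) (lookup c m) - single (m + v) (lookup c m))"
    by (subst sum_single_keys[symmetric, of c])
      (simp add: sum_distrib_right right_diff_distrib sum_subtractf mult_single)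
  then show ?thesis
    using assms by (simp add: phi_sum phi_diff phi_single phi_mon_add)
qed

text \<open>Choose one monomial of \<open>p\<close> in every fiber of \<open>phi_mon\<close>. Moving
  all terms to the chosen monomials gives 0, because the coefficients of \<open>p\<close> sum to 0
  over each fiber; subtracting this leaves binomials.\<close>

lemma I_binomials:
  assumes p: "p \<in> I"
  obtains rep where "\<And>m. m \<in> keys p \<Longrightarrow> keys (rep m) \<subseteq> Eset \<and> phi_mon (rep m) = phi_mon m"
    and "p = (\<Sum>m\<in>keys p. single 0 (lookup p m) * (single m 1 - single (rep m) 1))"
proof -
  define pick where "pick d = (SOME m. m \<in> keys p \<and> phi_mon m = d)" for d
  have pick: "pick (phi_mon m) \<in> keys p \<and> phi_mon (pick (phi_mon m)) = phi_mon m" if "m \<in> keys p" for m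
    unfolding pick_def using someI[of "\<lambda>m'. m' \<in> keys p \<and> phi_mon m' = phi_mon m" m] that by simp
  have "(\<Sum>m\<in>keys p. single (pick (phi_mon m)) (lookup p m)) = 0"
  proof (rule poly_mapping_eqI)
    fix x
    have "lookup (\<Sum>m\<in>keys p. single (pick (phi_mon m)) (lookup p m)) x
        = (\<Sum>m\<in>keys p. if pick (phi_mon m) = x then lookup p m else 0)"
      by (simp add: lookup_sum lookup_single when_def)
    \<comment> \<open>A chosen monomial collects the coefficients of its whole fiber, any other
      monomial collects nothing.\<close>
    also have "\<dots> = (if pick (phi_mon x) = x then \<Sum>m\<in>keys p. if phi_mon m = phi_mon x then lookup p m else 0 else 0)"
    proof (cases "pick (phi_mon x) = x")
      case True
      then have "pick (phi_mon m) = x \<longleftrightarrow> phi_mon m = phi_mon x" if "m \<in> keys p" for m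
        using pick[OF that] by auto
      then show ?thesis using True by (simp cong: sum.cong)
    next
      case False
      then have "pick (phi_mon m) \<noteq> x" if "m \<in> keys p" for m
        using pick[OF that] by auto
      then show ?thesis using False by simp
    qed
    also have "(\<Sum>m\<in>keys p. if phi_mon m = phi_mon x then lookup p m else 0) = lookup (phi p) (phi_mon x)"
      by (simp add: phi_def lookup_sum lookup_single when_def)
    also have "\<dots> = 0"
      using p by (simp add: I_def)
    finally show "lookup (\<Sum>m\<in>keys p. single (pick (phi_mon m)) (lookup p m)) x = lookup 0 x"
      by simp
  qed
  then have "p = (\<Sum>m\<in>keys p. single m (lookup p m) - single (pick (phi_mon m)) (lookup p m))"
    by (simp add: sum_subtractf sum_single_keys)
  then have "p = (\<Sum>m\<in>keys p. single 0 (lookup p m) * (single m 1 - single (pick (phi_mon m)) 1))"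
    by (simp add: right_diff_distrib mult_single)
  moreover have "keys m \<subseteq> Eset" if "m \<in> keys p" for m
    using p that by (simp add: I_def R_def)
  ultimately show thesis
    using that[of "\<lambda>m. pick (phi_mon m)"] pick by blast
qed

lemma gen_shift_in_shifts:
  assumes "set s \<subseteq> {1, 2}"
  shows "single (sh_mon t (gen_pos s)) 1 - single (sh_mon t (gen_neg s)) (1::'k::field) \<in> shifts G"
  unfolding shifts_def G_eq using assms
  by (auto simp: sh_diff sh_single
      intro!: exI[of _ t] exI[of _ "single (gen_pos s) 1 - single (gen_neg s) 1"])

lemma quad_shift_in_shifts:
  "single (edge (t + 1) (t + 2) + edge (t + 3) (t + 4)) 1
    - single (edge (t + 1) (t + 3) + edge (t + 2) (t + 4)) (1::'k::field) \<in> shifts G"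
  unfolding shifts_def G_eq
  by (rule CollectI, rule exI[of _ t],
      rule exI[of _ "single (edge 1 2 + edge 3 4) 1 - single (edge 1 3 + edge 2 4) 1"])
    (simp add: sh_diff sh_single sh_mon_add sh_mon_single add.commute)

lemma shifts_G_cases:
  assumes "g \<in> shifts (G :: 'k::field pol set)"
  obtains u v where "g = single u 1 - single v 1" "keys u \<subseteq> Eset" "keys v \<subseteq> Eset" "phi_mon u = phi_mon v"
proof -
  obtain t h where g: "g = sh t h" "h \<in> (G :: 'k pol set)"
    using assms unfolding shifts_def by blast
  from g(2) consider "h = single (edge 1 2 + edge 3 4) 1 - single (edge 1 3 + edge 2 4) 1"
    | s where "h = single (gen_pos s) 1 - single (gen_neg s) 1"
    unfolding G_eq by blast
  then show thesis
  proof cases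
    case 1
    show ?thesis
      by (rule that[of "sh_mon t (edge 1 2 + edge 3 4)" "sh_mon t (edge 1 3 + edge 2 4)"])
        (simp_all add: g 1 sh_diff sh_single sh_mon_add sh_mon_single keys_add_Eset Eset_iff
          phi_mon_add phi_mon_single ac_simps)
  next
    case 2
    show ?thesis
    proof (rule that[of "sh_mon t (gen_pos s)" "sh_mon t (gen_neg s)"])
      show "g = single (sh_mon t (gen_pos s)) 1 - single (sh_mon t (gen_neg s)) 1"
        by (simp add: g 2 sh_diff sh_single)
    qed (auto simp: gen_pos_def gen_neg_def sh_mon_mons keys_heavy_mon keys_light_mon
        phi_mon_eq_iff vdeg_mons)
  qed
qed

lemma conn_imp_ideal:
  assumes "conn u v"
  shows "single u 1 - single v (1::'k::field) \<in> ideal_gen_R (shifts G)"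
  using assms
proof (induction rule: conn.induct)
  case (quad n)
  \<comment> \<open>The quadric \<open>g2\<close> starts at vertex 1, so starting at
    \<open>n\<close> means shifting by \<open>n - 1\<close>.\<close>
  then obtain t where "n = t + 1" by (metis add.commute le_Suc_ex)
  then show ?case
    using ideal_gen_R_gen[OF quad_shift_in_shifts[of t], of 1] one_in_R(1)
    by (simp add: numeral_eq_Suc)
next
  case (walk s t)
  have "single (sh_mon t (gen_pos s)) 1 - single (sh_mon t (gen_neg s)) (1::'k) \<in> ideal_gen_R (shifts G)"
    using ideal_gen_R_gen[OF gen_shift_in_shifts[OF walk], of 1] one_in_R(1) by simp
  \<comment> \<open>Depending on \<open>flipped s\<close>, the shifted generator is this difference
    or its negative.\<close>
  then have "single (heavy_mon t s) 1 - single (light_mon t s) (1::'k) \<in> ideal_gen_R (shifts G) \<or>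
      single (light_mon t s) 1 - single (heavy_mon t s) (1::'k) \<in> ideal_gen_R (shifts G)"
    by (auto simp: gen_pos_def gen_neg_def sh_mon_mons split: if_splits)
  then show ?case
    using ideal_gen_R_mult[of "single (light_mon t s) 1 - single (heavy_mon t s) (1::'k)" _ "- 1"]
      one_in_R(2) by auto
next
  case (refl u)
  show ?case by (simp add: ideal_gen_R_zero)
next
  case (sym u v)
  then show ?case
    using ideal_gen_R_mult[OF sym.IH, of "- 1"] one_in_R(2) by simp
next
  case (trans u v w)
  then show ?case using ideal_gen_R_add[OF trans.IH] by simp
next
  case (add u v c)
  have "single c 1 * (single u 1 - single v (1::'k)) = single (u + c) 1 - single (v + c) 1"
    by (simp add: right_diff_distrib mult_single add.commute)
  then show ?case
    using ideal_gen_R_mult[OF add.IH single_in_R[OF add.hyps(2), of 1]] by simp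
qed

theorem ideal_gen_R_shifts_G: "ideal_gen_R (shifts (G :: 'k::field pol set)) = I"
proof (intro equalityI subsetI)
  fix p :: "'k pol"
  assume "p \<in> ideal_gen_R (shifts G)"
  then obtain F c where p: "p = (\<Sum>g\<in>F. c g * g)" "F \<subseteq> shifts G" "\<forall>g\<in>F. c g \<in> R"
    unfolding ideal_gen_R_def by blast
  have "c g * g \<in> R \<and> phi (c g * g) = 0" if "g \<in> F" for g
  proof -
    have "g \<in> shifts G" using that p(2) by blast
    then obtain u v where "g = single u 1 - single v 1" "keys u \<subseteq> Eset" "keys v \<subseteq> Eset" "phi_mon u = phi_mon v"
      by (rule shifts_G_cases)
    then show ?thesis
      using that p(3) by (auto intro!: R_mult R_diff single_in_R phi_mult_binomial)
  qed
  then show "p \<in> I"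
    by (simp add: I_def p(1) R_sum phi_sum)
next
  fix p :: "'k pol"
  assume p: "p \<in> I"
  then obtain rep where rep: "\<And>m. m \<in> keys p \<Longrightarrow> keys (rep m) \<subseteq> Eset \<and> phi_mon (rep m) = phi_mon m"
    and eq: "p = (\<Sum>m\<in>keys p. single 0 (lookup p m) * (single m 1 - single (rep m) 1))"
    using I_binomials by blast
  have "single 0 (lookup p m) * (single m 1 - single (rep m) 1) \<in> ideal_gen_R (shifts G)"
    if "m \<in> keys p" for m
  proof -
    have "keys m \<subseteq> Eset" using p that by (simp add: I_def R_def)
    then have "conn m (rep m)"
      using rep[OF that] by (intro conn_fiber) (auto simp: phi_mon_eq_iff)
    then show ?thesis
      by (intro ideal_gen_R_mult conn_imp_ideal single_in_R) simp_all
  qed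
  then show "p \<in> ideal_gen_R (shifts G)"
    by (subst eq) (rule ideal_gen_R_sum)
qed

subsection \<open>Minimality\<close>

lemma vdeg_light_part_eq_0:
  assumes "n + 1 \<ge> path_end t s"
  shows "vdeg (light_part t s) n = 0"
  using vdeg_eq[OF conjunct2[OF keys_parts], of t s n] assms path_end_ge[of t s]
  by (simp add: light_part_eq_0)

lemma vdeg_heavy_mon:
  "vdeg (heavy_mon t s) n = vdeg (light_part t s) n + (if n = path_end t s then 2 else 0)
    + (if n = path_end t s + 1 \<or> n = path_end t s + 2 then 1 else 0)"
  by (auto simp: heavy_mon_def vdeg_parts)

text \<open>Degree 0 at \<open>k - 1\<close>, \<open>k + 3\<close> and \<open>k + 4\<close> excludes
  all edges but those of the triangle and \<open>(k - 2, k)\<close>. Degree 1 at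
  \<open>k + 1\<close> and \<open>k + 2\<close> then forces either the top edge or both edges at
  \<open>k\<close>.\<close>

lemma split_last_triangle:
  fixes k
  assumes km: "keys m \<subseteq> Eset" and "k \<ge> 3"
    and deg: "vdeg m (k - 1) = 0" "vdeg m k = 2" "vdeg m (k + 1) = 1" "vdeg m (k + 2) = 1"
      "vdeg m (k + 3) = 0" "vdeg m (k + 4) = 0"
  obtains r where "m = r + edge2 (k - 2) k + edge (k + 1) (k + 2)"
  | r where "m = r + edge k (k + 1) + edge k (k + 2)"
proof -
  note zero = vdeg_eq_0_lookup[OF km]
  have z: "lookup m (k - 1, k) = 0" "lookup m (k - 1, k + 1) = 0" "lookup m (k + 1, k + 3) = 0"
    "lookup m (k + 2, k + 3) = 0" "lookup m (k + 2, k + 4) = 0"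
    using deg(1,5,6) by (simp_all add: zero)
  have d0: "lookup m (k - 2, k) + lookup m (k, k + 1) + lookup m (k, k + 2) = 2"
    using vdeg_eq[OF km, of k] deg(2) z(1) by simp
  have d1: "lookup m (k, k + 1) + lookup m (k + 1, k + 2) = 1"
    using vdeg_eq[OF km, of "k + 1"] deg(3) z(2,3) by (simp add: numeral_eq_Suc)
  have d2: "lookup m (k, k + 2) + lookup m (k + 1, k + 2) = 1"
    using vdeg_eq[OF km, of "k + 2"] deg(4) z(4,5) by (simp add: numeral_eq_Suc)
  show thesis
  proof (cases "lookup m (k + 1, k + 2) = 0")
    case True
    then have le: "lookup (0 + edge k (k + 1) + edge k (k + 2)) x \<le> lookup m x" for x
      using d1 d2 by (intro add_single_le) (simp_all add: lookup_single)
    show thesis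
      using le_imp_add_diff[OF le]
      by (intro that(2)[of "m - (0 + edge k (k + 1) + edge k (k + 2))"]) (simp add: ac_simps)
  next
    case False
    then have le: "lookup (0 + edge2 (k - 2) k + edge (k + 1) (k + 2)) x \<le> lookup m x" for x
      using d0 d1 d2 \<open>k \<ge> 3\<close> by (intro add_single_le) (simp_all add: lookup_single)
    show thesis
      using le_imp_add_diff[OF le]
      by (intro that(1)[of "m - (0 + edge2 (k - 2) k + edge (k + 1) (k + 2))"]) (simp add: ac_simps)
  qed
qed

lemma heavy_mon_lookup: "lookup (heavy_mon t s) (path_end t s, path_end t s + 1) = 0"
  by (simp add: heavy_mon_def lookup_add lookup_single heavy_part_eq_0)

lemma light_mon_lookup: "lookup (light_mon t s) (path_end t s + 1, path_end t s + 2) = 0"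
  by (simp add: light_mon_def lookup_add lookup_single light_part_eq_0)

text \<open>Induction along the path: after removing the last triangle and, where needed, the
  doubled edge, the rest has the degrees of a part for the shorter list.\<close>

lemma fiber_heavy_light:
  assumes "keys m \<subseteq> Eset" "\<And>n. vdeg m n = vdeg (heavy_mon t s) n"
  shows "m = heavy_mon t s \<or> m = light_mon t s"
  using assms
proof (induction s arbitrary: m)
  case Nil
  note km = Nil.prems(1)
  have deg: "vdeg m n = (if n = t + 1 \<or> n = t + 2 \<or> n = t + 6 \<or> n = t + 7 then 1 else 0)
      + (if n = t + 3 \<or> n = t + 5 then 2 else 0)" for n
    using Nil.prems(2)[of n] by (auto simp: heavy_mon_def)
  have "m = heavy_mon t [] \<or> m = light_mon t []"
  proof (rule split_last_triangle[OF km, of "t + 5"])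
    fix r
    assume m: "m = r + edge2 (t + 5 - 2) (t + 5) + edge (t + 5 + 1) (t + 5 + 2)"
    have kr: "keys r \<subseteq> Eset" using km by (simp add: m keys_add_Eset)
    have dr: "vdeg r n = (if n = t + 1 \<or> n = t + 2 then 1 else 0)" for n
      using deg[of n] by (auto simp: m split: if_splits)
    \<comment> \<open>Only two vertices have positive degree, so \<open>i < j\<close> leaves a
      single possible edge.\<close>
    have z: "lookup r (i, j) = 0" if "i \<noteq> t + 1 \<or> j \<noteq> t + 2" "i < j" for i j
      using that by (intro vdeg_eq_0_lookup[OF kr]) (auto simp: dr)
    have "lookup r (t + 1, t + 2) = 1"
      using vdeg_eq[OF kr, of "t + 1"] dr[of "t + 1"] by (simp add: z)
    then have "r = edge (t + 1) (t + 2) + (r - edge (t + 1) (t + 2))"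
      by (intro edge_split[symmetric]) simp
    then obtain q where r: "r = edge (t + 1) (t + 2) + q" by blast
    have "vdeg q n = 0" for n
      using dr[of n] by (auto simp: r split: if_splits)
    then have "q = 0"
      using kr by (intro vdeg_all_0_imp_0) (simp_all add: r keys_add_Eset)
    then show ?thesis
      by (simp add: m r heavy_mon_def numeral_eq_Suc)
  next
    fix r
    assume m: "m = r + edge (t + 5) (t + 5 + 1) + edge (t + 5) (t + 5 + 2)"
    have kr: "keys r \<subseteq> Eset" using km by (simp add: m keys_add_Eset)
    have dr: "vdeg r n = (if n = t + 1 \<or> n = t + 2 then 1 else 0) + (if n = t + 3 then 2 else 0)" for n
      using deg[of n] by (auto simp: m split: if_splits)
    have z: "lookup r (i, j) = 0" if "i \<notin> {t + 1, t + 2, t + 3} \<or> j \<notin> {t + 1, t + 2, t + 3}" for i j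
      using that by (intro vdeg_eq_0_lookup[OF kr]) (auto simp: dr)
    have "lookup r (t - 1, t + 1) = 0"
      by (intro z) auto
    moreover have "t + 1 - 2 = t - 1" by simp
    ultimately have d1: "lookup r (t + 1, t + 2) + lookup r (t + 1, t + 3) = 1"
      using vdeg_eq[OF kr, of "t + 1"] dr[of "t + 1"] z by (simp add: numeral_eq_Suc)
    have d2: "lookup r (t + 1, t + 2) + lookup r (t + 2, t + 3) = 1"
      using vdeg_eq[OF kr, of "t + 2"] dr[of "t + 2"] z by (simp add: numeral_eq_Suc)
    have d3: "lookup r (t + 1, t + 3) + lookup r (t + 2, t + 3) = 2"
      using vdeg_eq[OF kr, of "t + 3"] dr[of "t + 3"] z by (simp add: numeral_eq_Suc)
    \<comment> \<open>On the first triangle with degrees 1, 1, 2 the three balances have a unique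
      solution.\<close>
    have le: "lookup (0 + edge (t + 1) (t + 3) + edge (t + 2) (t + 3)) x \<le> lookup r x" for x
      using d1 d2 d3 by (intro add_single_le) (simp_all add: lookup_single)
    obtain q where r: "r = 0 + edge (t + 1) (t + 3) + edge (t + 2) (t + 3) + q"
      using le_imp_add_diff[OF le] by metis
    have "vdeg q n = 0" for n
      using dr[of n] by (auto simp: r split: if_splits)
    then have "q = 0"
      using kr by (intro vdeg_all_0_imp_0) (simp_all add: r keys_add_Eset)
    then show ?thesis
      by (simp add: m r light_mon_def numeral_eq_Suc)
  qed (simp_all add: deg)
  then show ?case .
next
  case (Cons a s)
  note km = Cons.prems(1)
  define k where "k = path_end t s"
  have k5: "k \<ge> t + 5" using path_end_ge by (simp add: k_def)
  \<comment> \<open>The induction hypothesis concerns complete monomials, so \<open>r\<close> is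
    closed up by a triangle first; the exponent of one triangle edge then rules out the wrong
    alternative.\<close>
  have light: "r = light_part t s" if "keys r \<subseteq> Eset" "\<And>n. vdeg r n = vdeg (light_part t s) n" for r
  proof -
    have "r + edge k (k + 1) + edge k (k + 2) = heavy_mon t s
        \<or> r + edge k (k + 1) + edge k (k + 2) = light_mon t s"
      using that k5 by (intro Cons.IH) (auto simp: keys_add_Eset Eset_iff vdeg_heavy_mon k_def)
    moreover have "r + edge k (k + 1) + edge k (k + 2) \<noteq> heavy_mon t s"
    proof
      assume "r + edge k (k + 1) + edge k (k + 2) = heavy_mon t s"
      then have "lookup (r + edge k (k + 1) + edge k (k + 2)) (k, k + 1) = 0"
        by (simp only: heavy_mon_lookup k_def)
      then show False by (simp add: lookup_add)
    qed
    ultimately show ?thesis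
      by (simp add: light_mon_def k_def)
  qed
  have heavy: "r = heavy_part t s" if "keys r \<subseteq> Eset" "\<And>n. vdeg r n = vdeg (heavy_part t s) n" for r
  proof -
    have "r + edge (k + 1) (k + 2) = heavy_mon t s \<or> r + edge (k + 1) (k + 2) = light_mon t s"
      using that k5 by (intro Cons.IH) (auto simp: keys_add_Eset Eset_iff heavy_mon_def k_def)
    moreover have "r + edge (k + 1) (k + 2) \<noteq> light_mon t s"
    proof
      assume "r + edge (k + 1) (k + 2) = light_mon t s"
      then have "lookup (r + edge (k + 1) (k + 2)) (k + 1, k + 2) = 0"
        by (simp only: light_mon_lookup k_def)
      then show False by (simp add: lookup_add)
    qed
    ultimately show ?thesis
      by (simp add: heavy_mon_def k_def)
  qed
  have low: "vdeg (light_part t s) n = 0" if "n + 1 \<ge> k" for n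
    using that by (simp add: k_def vdeg_light_part_eq_0)
  define K where "K = path_end t (a # s)"
  have deg: "vdeg m n = vdeg (light_part t (a # s)) n + (if n = K then 2 else 0)
    + (if n = K + 1 \<or> n = K + 2 then 1 else 0)" for n
    using Cons.prems(2)[of n] unfolding vdeg_heavy_mon K_def .
  have lowK: "vdeg (light_part t (a # s)) n = 0" if "n + 1 \<ge> K" for n
    using that unfolding K_def by (rule vdeg_light_part_eq_0)
  have K5: "K \<ge> t + 5" using path_end_ge[of t "a # s"] unfolding K_def .
  have "vdeg m (K - 1) = 0" "vdeg m K = 2" "vdeg m (K + 1) = 1" "vdeg m (K + 2) = 1"
      "vdeg m (K + 3) = 0" "vdeg m (K + 4) = 0"
    using K5 by (auto simp: deg lowK simp del: light_part.simps)
  with km K5 consider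
    r where "m = r + edge2 (K - 2) K + edge (K + 1) (K + 2)"
    | r where "m = r + edge K (K + 1) + edge K (K + 2)"
    by (elim split_last_triangle[of m K, rotated 2]) auto
  then show ?case
  proof cases
    case 1
    then have kr: "keys r \<subseteq> Eset" using km by (simp add: keys_add_Eset)
    have dr: "vdeg r n + (if n = K - 2 then 2 else 0) = vdeg (light_part t (a # s)) n" for n
      using deg[of n] K5 by (auto simp: 1 split: if_splits)
    show ?thesis
    proof (cases "a = 1")
      case True
      then have "K = k + 2" by (simp add: K_def k_def)
      have "vdeg r n = vdeg (light_part t s) n" for n
        using dr[of n] True \<open>K = k + 2\<close> by (simp add: vdeg_parts k_def split: if_splits)
      then have "r = light_part t s" using light kr by blast
      then show ?thesis using True 1 \<open>K = k + 2\<close>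
        by (simp add: heavy_mon_def k_def)
    next
      case False
      then have "K = k + 3" by (simp add: K_def k_def)
      have "vdeg r n = vdeg (heavy_part t s) n" for n
        using dr[of n] False \<open>K = k + 3\<close> by (auto simp: vdeg_parts k_def split: if_splits)
      then have "r = heavy_part t s" using heavy kr by blast
      then show ?thesis using False 1 \<open>K = k + 3\<close>
        by (simp add: heavy_mon_def k_def)
    qed
  next
    case 2
    then have kr: "keys r \<subseteq> Eset" using km by (simp add: keys_add_Eset)
    have dr: "vdeg r n = vdeg (light_part t (a # s)) n" for n
      using deg[of n] by (auto simp: 2 split: if_splits)
    show ?thesis
    proof (cases "a = 1")
      case True
      then have "r = heavy_part t s" using heavy kr dr by simp
      then show ?thesis using True 2
        by (simp add: light_mon_def K_def)
    next
      case False
      have drs: "vdeg r n = vdeg (light_part t s) n + (if n = k \<or> n = k + 1 then 2 else 0)" for n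
        using dr[of n] False by (simp add: k_def)
      \<comment> \<open>All neighbours of \<open>k + 1\<close> other than \<open>k\<close> have
        degree 0, so its degree 2 comes entirely from \<open>(k, k + 1)\<close>.\<close>
      have "lookup r (k - 1, k + 1) = 0" "lookup r (k + 1, k + 2) = 0" "lookup r (k + 1, k + 3) = 0"
        using k5 by (auto intro!: vdeg_eq_0_lookup[OF kr] simp: drs low)
      then have "lookup r (k, k + 1) = 2"
        using vdeg_eq[OF kr, of "k + 1"] drs[of "k + 1"] by (simp add: low numeral_eq_Suc)
      then have le: "lookup (0 + edge2 k (k + 1)) x \<le> lookup r x" for x
        by (intro add_single_le) simp_all
      define q where "q = r - (0 + edge2 k (k + 1))"
      have r: "r = q + edge2 k (k + 1)"
        using le_imp_add_diff[OF le] by (simp add: q_def add.commute)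
      have "vdeg q n = vdeg (light_part t s) n" for n
        using drs[of n] by (auto simp: r split: if_splits)
      moreover have "keys q \<subseteq> Eset"
        using kr by (simp add: r keys_add_Eset)
      ultimately have "q = light_part t s" using light by blast
      then show ?thesis using False 2
        by (simp add: light_mon_def K_def k_def r)
    qed
  qed
qed

text \<open>Such a monomial is a perfect matching of the vertices 1 to 4, and \<open>(1, 4)\<close>
  is not an edge, so only two matchings remain.\<close>

lemma fiber_quad:
  assumes km: "keys m \<subseteq> Eset" and deg: "\<And>n. vdeg m n = vdeg (edge 1 2 + edge 3 4) n"
  shows "m = edge 1 2 + edge 3 4 \<or> m = edge 1 3 + edge 2 4"
proof -
  have dm: "vdeg m n = (if n \<in> {1, 2, 3, 4} then 1 else 0)" for n
    using deg[of n] by simp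
  have z: "lookup m (i, j) = 0" if "i \<notin> {1, 2, 3, 4} \<or> j \<notin> {1, 2, 3, 4}" for i j
    using that by (intro vdeg_eq_0_lookup[OF km]) (auto simp: dm)
  have "lookup m (0, 1) = 0" "lookup m (0, 2) = 0" "lookup m (3, 5) = 0"
    "lookup m (4, 5) = 0" "lookup m (4, 6) = 0"
    by (rule z, simp)+
  note outer = this
  have deg_1: "vdeg m 1 = 1" "vdeg m 2 = 1" "vdeg m 3 = 1" "vdeg m 4 = 1"
    by (simp_all add: dm)
  \<comment> \<open>For \<open>n = 1\<close> both \<open>n - 2\<close> and \<open>n - 1\<close>
    truncate to 0, which produces the factor 2; that exponent is 0.\<close>
  have "vdeg m 1 = 2 * lookup m (0, 1) + lookup m (1, 2) + lookup m (1, 3)"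
    using vdeg_eq[OF km, of 1] by (simp add: numeral_eq_Suc)
  then have d1: "lookup m (1, 2) + lookup m (1, 3) = 1"
    using deg_1 outer by linarith
  have "vdeg m 2 = lookup m (0, 2) + lookup m (1, 2) + lookup m (2, 3) + lookup m (2, 4)"
    using vdeg_eq[OF km, of 2] by (simp add: numeral_eq_Suc)
  then have d2: "lookup m (1, 2) + lookup m (2, 3) + lookup m (2, 4) = 1"
    using deg_1 outer by linarith
  have "vdeg m 3 = lookup m (1, 3) + lookup m (2, 3) + lookup m (3, 4) + lookup m (3, 5)"
    using vdeg_eq[OF km, of 3] by (simp add: numeral_eq_Suc)
  then have d3: "lookup m (1, 3) + lookup m (2, 3) + lookup m (3, 4) = 1"
    using deg_1 outer by linarith
  have "vdeg m 4 = lookup m (2, 4) + lookup m (3, 4) + lookup m (4, 5) + lookup m (4, 6)"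
    using vdeg_eq[OF km, of 4] by (simp add: numeral_eq_Suc)
  then have d4: "lookup m (2, 4) + lookup m (3, 4) = 1"
    using deg_1 outer by linarith
  have quad: "m = edge i j + edge i' j'"
    if "lookup m (i, j) = 1" "lookup m (i', j') = 1" "(i, j) \<noteq> (i', j')"
      "\<And>n. vdeg m n = vdeg (edge i j + edge i' j') n" for i j i' j'
  proof -
    have le: "lookup (0 + edge i j + edge i' j') x \<le> lookup m x" for x
      using that(1-3) by (intro add_single_le) (auto simp: lookup_single when_def)
    obtain q where m: "m = 0 + edge i j + edge i' j' + q"
      using le_imp_add_diff[OF le] by metis
    have "vdeg q n = 0" for n
      using that(4)[of n] by (simp add: m)
    then have "q = 0"
      using km by (intro vdeg_all_0_imp_0) (simp_all add: m keys_add_Eset)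
    then show ?thesis by (simp add: m)
  qed
  show ?thesis
  proof (cases "lookup m (1, 2) = 1")
    case True
    then have "lookup m (3, 4) = 1" using d1 d2 d3 d4 by linarith
    then show ?thesis using quad[of 1 2 3 4] True deg by simp
  next
    case False
    then have "lookup m (1, 3) = 1" "lookup m (2, 4) = 1" using d1 d2 d3 d4 by linarith+
    then show ?thesis using quad[of 1 3 2 4] dm by simp
  qed
qed

section \<open>Normalisation by the first edge\<close>

lemma parts_first_edge:
  "lookup (heavy_part 0 s) (1, 2) = (if flipped s then 0 else 1)"
  "lookup (light_part 0 s) (1, 2) = (if flipped s then 1 else 0)"
proof (induction s)
  case Nil
  { case 1 show ?case by (simp add: lookup_add lookup_single) }
  { case 2 show ?case by (simp add: lookup_add lookup_single) }
next
  case (Cons a s)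
  have "path_end 0 s \<ge> 5" using path_end_ge[of 0 s] by simp
  { case 1 show ?case using Cons \<open>path_end 0 s \<ge> 5\<close> by (auto simp: lookup_add lookup_single when_def) }
  { case 2 show ?case using Cons \<open>path_end 0 s \<ge> 5\<close> by (auto simp: lookup_add lookup_single when_def) }
qed

lemma gen_first_edge: "lookup (gen_pos s) (1, 2) = 1" "lookup (gen_neg s) (1, 2) = 0"
  using path_end_ge[of 0 s]
  by (auto simp: gen_pos_def gen_neg_def heavy_mon_def light_mon_def lookup_add
      parts_first_edge[unfolded One_nat_def]
      lookup_single when_def)

text \<open>The conditions at \<open>(1, 2)\<close> pin down the shift and the sign of the binomial.\<close>

definition indispensable :: "mon \<Rightarrow> mon \<Rightarrow> bool" where
  "indispensable u v \<longleftrightarrow> keys u \<subseteq> Eset \<and> keys v \<subseteq> Eset \<and> (\<forall>x. lookup u x = 0 \<or> lookup v x = 0)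
    \<and> phi_mon u = phi_mon v \<and> lookup u (1, 2) \<noteq> 0 \<and> lookup v (1, 2) = 0
    \<and> (\<forall>m. keys m \<subseteq> Eset \<and> phi_mon m = phi_mon u \<longrightarrow> m = u \<or> m = v)"

lemma G_indispensable:
  assumes "g \<in> (G :: 'k::field pol set)"
  obtains u v where "g = single u 1 - single v 1" "indispensable u v"
proof -
  have "indispensable (edge 1 2 + edge 3 4) (edge 1 3 + edge 2 4)"
  proof -
    have "keys (edge 1 2 + edge 3 4) \<subseteq> Eset" "keys (edge 1 3 + edge 2 4) \<subseteq> Eset"
      by (simp_all add: keys_add_Eset Eset_iff)
    moreover have "lookup (edge 1 2 + edge 3 4) x = 0 \<or> lookup (edge 1 3 + edge 2 4) x = 0" for x
      by (auto simp: lookup_add lookup_single when_def)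
    moreover have "phi_mon (edge 1 2 + edge 3 4) = phi_mon (edge 1 3 + edge 2 4)"
      by (simp add: phi_mon_add phi_mon_single ac_simps)
    moreover have "lookup (edge 1 2 + edge 3 4) (1, 2) \<noteq> 0" "lookup (edge 1 3 + edge 2 4) (1, 2) = 0"
      by (simp_all add: lookup_add lookup_single)
    ultimately show ?thesis
      unfolding indispensable_def using fiber_quad phi_mon_eq_iff by blast
  qed
  moreover have "indispensable (gen_pos s) (gen_neg s)" for s
  proof -
    have "m = gen_pos s \<or> m = gen_neg s" if "keys m \<subseteq> Eset" "\<forall>n. vdeg m n = vdeg (gen_pos s) n" for m
      using fiber_heavy_light[of m 0 s] that by (auto simp: gen_pos_def gen_neg_def vdeg_mons)
    then show ?thesis
      unfolding indispensable_def phi_mon_eq_iff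
      using keys_gen[of s] gen_disjoint[of s] vdeg_gen[of s] gen_first_edge[of s] by simp
  qed
  ultimately show thesis
    using assms that unfolding G_eq by blast
qed

section \<open>Shifts of indispensable binomials\<close>

lemma vdeg_sh_mon: "vdeg (sh_mon t m) n = (if n \<ge> t then vdeg m (n - t) else 0)"
proof -
  have "vdeg (sh_mon t (single v c)) n = (if n \<ge> t then vdeg (single v c) (n - t) else 0)" for v c
    by (cases v) (auto simp: sh_mon_single)
  then have "vdeg (sh_mon t (\<Sum>v\<in>F. single v (lookup m v))) n =
      (if n \<ge> t then vdeg (\<Sum>v\<in>F. single v (lookup m v)) (n - t) else 0)" for F
    by (induction F rule: infinite_finite_induct) (auto simp: sh_mon_add sh_mon_def[of _ 0])
  from this[of "keys m"] show ?thesis by (simp add: sum_single_keys)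
qed

lemma lookup_sh_mon: "lookup (sh_mon t m) (i + t, j + t) = lookup m (i, j)"
proof -
  have "lookup (sh_mon t m) (i + t, j + t) = (\<Sum>v\<in>keys m. if v = (i, j) then lookup m (i, j) else 0)"
    unfolding sh_mon_def lookup_sum by (rule sum.cong) (auto simp: lookup_single when_def prod_eq_iff)
  also have "\<dots> = lookup m (i, j)"
    by (simp add: in_keys_iff)
  finally show ?thesis .
qed

lemma sh_mon_0: "sh_mon 0 m = m"
  by (simp add: sh_mon_def sum_single_keys)

lemma keys_sh_mon:
  assumes "keys m \<subseteq> Eset" shows "keys (sh_mon t m) \<subseteq> Eset"
proof -
  have "keys (sh_mon t m) \<subseteq> (\<Union>v\<in>keys m. keys (single (fst v + t, snd v + t) (lookup m v)))"
    unfolding sh_mon_def by (rule keys_sum)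
  also have "\<dots> \<subseteq> Eset"
    using assms by (auto simp: Eset_def split: if_splits)
  finally show ?thesis .
qed

text \<open>Replacing \<open>a\<close> by \<open>b\<close> stays in the two-element fiber of
  \<open>u\<close>, so \<open>r + b\<close> is \<open>v\<close>. Coprimality of \<open>u\<close> and
  \<open>v\<close> then forces \<open>r = 0\<close>.\<close>

lemma indispensable_divisor:
  assumes uv: "indispensable u v" and ab: "keys a \<subseteq> Eset" "keys b \<subseteq> Eset" "phi_mon a = phi_mon b" "a \<noteq> b"
    and u: "u = r + a"
  shows "a = u \<and> b = v"
proof -
  have "keys (r + b) \<subseteq> Eset" "phi_mon (r + b) = phi_mon u"
    using uv ab by (simp_all add: indispensable_def u keys_add_Eset phi_mon_add)
  then have "r + b = u \<or> r + b = v"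
    using uv by (simp add: indispensable_def)
  then have v: "v = r + b"
    using \<open>a \<noteq> b\<close> u by auto
  have "\<forall>x. lookup u x = 0 \<or> lookup v x = 0"
    using uv unfolding indispensable_def by (elim conjE)
  then have "r = 0"
    by (intro poly_mapping_eqI) (metis add_is_0 lookup_add lookup_zero u v)
  then show ?thesis by (simp add: u v)
qed

lemma indispensable_shift:
  assumes uv: "indispensable u v" and ab: "indispensable a b"
    and div: "u = r + sh_mon t a \<or> u = r + sh_mon t b"
  shows "a = u \<and> b = v"
proof -
  have k: "keys (sh_mon t a) \<subseteq> Eset" "keys (sh_mon t b) \<subseteq> Eset"
    using ab by (simp_all add: indispensable_def keys_sh_mon)
  have p: "phi_mon (sh_mon t a) = phi_mon (sh_mon t b)"
    using ab by (simp add: indispensable_def phi_mon_eq_iff vdeg_sh_mon)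
  have "lookup (sh_mon t a) (1 + t, 2 + t) \<noteq> lookup (sh_mon t b) (1 + t, 2 + t)"
    unfolding lookup_sh_mon using ab by (simp add: indispensable_def)
  then have ne: "sh_mon t a \<noteq> sh_mon t b" by auto
  have *: "sh_mon t a = u \<and> sh_mon t b = v \<or> sh_mon t b = u \<and> sh_mon t a = v"
    using div indispensable_divisor[OF uv k p ne] indispensable_divisor[OF uv k(2,1) p[symmetric] ne[symmetric]]
    by blast
  \<comment> \<open>A positive shift would leave vertex 1 with degree 0, so \<open>t = 0\<close>;
    afterwards the exponent of \<open>(1, 2)\<close> excludes the exchanged pair.\<close>
  have "vdeg u 1 > 0"
    using uv vdeg_eq_0_lookup[of u 1 2] unfolding indispensable_def by (metis gr0I)
  then have "vdeg (sh_mon t a) 1 > 0 "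
    using * p by (auto simp: phi_mon_eq_iff)
  then have "t = 0"
    using vdeg_0_eq_0[of a] ab by (cases t) (auto simp: vdeg_sh_mon indispensable_def split: if_splits)
  then show ?thesis
    using * uv ab by (auto simp: sh_mon_0 indispensable_def)
qed

theorem ideal_gen_R_shifts_proper:
  assumes "H \<subset> (G :: 'k::field pol set)"
  shows "ideal_gen_R (shifts H) \<noteq> I"
proof -
  obtain g where g: "g \<in> G" "g \<notin> H" using assms by blast
  obtain u v where uv: "g = single u 1 - single v 1" "indispensable u v"
    using g(1) by (rule G_indispensable)
  have "u \<noteq> v" using uv(2) by (auto simp: indispensable_def)
  \<comment> \<open>The coefficient at \<open>u\<close> separates the ideal of \<open>H\<close> from
    \<open>g\<close>.\<close>
  have "lookup p u = 0" if p: "p \<in> ideal_gen_R (shifts H)" for p :: "'k pol"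
  proof -
    obtain F c where F: "p = (\<Sum>h\<in>F. c h * h)" "F \<subseteq> shifts H"
      using p unfolding ideal_gen_R_def by blast
    have "lookup (c h * h) u = 0" if "h \<in> F" for h
    proof -
      obtain t h' where h: "h = sh t h'" "h' \<in> H"
        using \<open>h \<in> F\<close> F(2) unfolding shifts_def by blast
      then obtain a b where ab: "h' = single a 1 - single b 1" "indispensable a b"
        using assms by (blast elim: G_indispensable)
      have "\<not> (a = u \<and> b = v)"
        using h(2) g(2) ab(1) uv(1) by auto
      then have "u \<noteq> r + sh_mon t a" "u \<noteq> r + sh_mon t b" for r
        using indispensable_shift[OF uv(2) ab(2)] by blast+
      moreover have "keys h \<subseteq> {sh_mon t a, sh_mon t b}"
        unfolding h(1) ab(1) sh_diff sh_single
        using keys_diff[of "single (sh_mon t a) (1::'k)" "single (sh_mon t b) 1"] by auto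
      ultimately have "u \<notin> keys (c h * h)"
        using keys_mult[of "c h" h] by blast
      then show ?thesis by (simp add: in_keys_iff)
    qed
    then show ?thesis by (simp add: F(1) lookup_sum)
  qed
  moreover have "lookup g u \<noteq> 0"
    using \<open>u \<noteq> v\<close> by (simp add: uv(1) lookup_minus lookup_single)
  moreover have "g \<in> I"
    using uv by (auto simp: I_def indispensable_def phi_diff phi_single intro!: R_diff single_in_R)
  ultimately show ?thesis by blast
qed

theorem theorem6p8:
  shows "ideal_gen_R (shifts (G :: 'k::field pol set)) = I
     \<and> (\<forall>H. H \<subset> (G :: 'k pol set) \<longrightarrow> ideal_gen_R (shifts H) \<noteq> I)"
  using ideal_gen_R_shifts_G ideal_gen_R_shifts_proper by blast

end
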